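(* Let $n$ be given. Then, for any positive $z<\frac{1}{n(n-1)}$, the number of queries required to decide the existence of a connected allocation for $n$ agents in which every agent $i$ receives a piece with value more than $w_i+z$, or to compute such an allocation if it exists, is in $\Theta(n\cdot 2^n)$, even for hungry agents with equal entitlements.
   Context: The cake is $C=[0,1]$, to be divided among agents $[n]$. Each agent $i$ has a valuation function $V_i$ on the algebra generated by intervals of $C$ that is non-negative, finitely additive, normalized ($V_i(C)=1$), with $x\mapsto V_i([0,x])$ continuous. Agent $i$ is hungry if $V_i(X)>0$ for every interval $X$ of positive length. Entitlements are $w_i>0$ with $\sum_i w_i=1$; equal entitlements means $w_i=1/n$. An allocation is a partition $C=X_1\sqcup\cdots\sqcup X_n$ into finite unions of closed intervals, pairwise disjoint except possibly at endpoints, with $X_i$ given to agent $i$; it is connected if each $X_i$ is a single interval. Algorithms access valuations only via queries (each counts as one): $\textsc{Eval}_i(x,y)=V_i([x,y])$; $\textsc{Mark}_i(x,r)$ returns the largest $z\in C$ with $V_i([x,z])=r$, or $\infty$ if $V_i([x,1])<r$. *)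

theory Defs
  imports "HOL-Analysis.Analysis" "HOL-Library.Landau_Symbols" "HOL-Library.Extended_Nat"
begin

definition cake :: "real set" where
  "cake = {0..1}"

definition cake_algebra :: "real set set" where
  "cake_algebra = \<Inter>{M. algebra cake M \<and> {I. is_interval I \<and> I \<subseteq> cake} \<subseteq> M}"

text \<open>
  Continuity of \<open>x \<mapsto> V [0,x]\<close> on the cake rules out atoms at every point except \<open>0\<close>. The condition
  \<open>V {0} = 0\<close> excludes the remaining one; without it a Mark query at \<open>0\<close> with target strictly
  between \<open>0\<close> and \<open>V {0}\<close> would have no answer.
\<close>

definition valuation :: "(real set \<Rightarrow> real) \<Rightarrow> bool" where
  "valuation V \<longleftrightarrow>
     (\<forall>A\<in>cake_algebra. 0 \<le> V A) \<and>
     additive cake_algebra V \<and>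
     V cake = 1 \<and>
     V {0} = 0 \<and>
     continuous_on cake (\<lambda>x. V {0..x})"

definition hungry :: "(real set \<Rightarrow> real) \<Rightarrow> bool" where
  "hungry V \<longleftrightarrow> (\<forall>X. is_interval X \<longrightarrow> X \<subseteq> cake \<longrightarrow> measure lborel X > 0 \<longrightarrow> V X > 0)"

text \<open>A profile assigns a valuation to each agent; only the values at the agents \<open>1, \<dots>, n\<close> matter.\<close>

type_synonym profile = "nat \<Rightarrow> real set \<Rightarrow> real"

definition all_profiles :: "nat \<Rightarrow> profile set" where
  "all_profiles n = {V. \<forall>i\<in>{1..n}. valuation (V i)}"

definition hungry_profiles :: "nat \<Rightarrow> profile set" where
  "hungry_profiles n = {V. \<forall>i\<in>{1..n}. valuation (V i) \<and> hungry (V i)}"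

definition entitlements :: "nat \<Rightarrow> (nat \<Rightarrow> real) set" where
  "entitlements n = {w. (\<forall>i\<in>{1..n}. w i > 0) \<and> (\<Sum>i=1..n. w i) = 1}"

definition equal_entitlements :: "nat \<Rightarrow> nat \<Rightarrow> real" where
  "equal_entitlements n = (\<lambda>i. 1 / real n)"

text \<open>
  For a finite union of closed intervals, the frontier (in the real line) consists exactly of the
  endpoints of its maximal intervals.
\<close>

definition allocation :: "nat \<Rightarrow> (nat \<Rightarrow> real set) \<Rightarrow> bool" where
  "allocation n X \<longleftrightarrow>
     (\<Union>i\<in>{1..n}. X i) = cake \<and>
     (\<forall>i\<in>{1..n}. \<exists>K. finite K \<and> (\<forall>I\<in>K. \<exists>a b. a \<le> b \<and> I = {a..b}) \<and> X i = \<Union>K) \<and>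
     (\<forall>i\<in>{1..n}. \<forall>j\<in>{1..n}. i \<noteq> j \<longrightarrow> X i \<inter> X j \<subseteq> frontier (X i) \<inter> frontier (X j))"

definition connected_allocation :: "nat \<Rightarrow> (nat \<Rightarrow> real set) \<Rightarrow> bool" where
  "connected_allocation n X \<longleftrightarrow> allocation n X \<and> (\<forall>i\<in>{1..n}. \<exists>a b. X i = {a..b})"

definition surplus_allocation ::
    "nat \<Rightarrow> (nat \<Rightarrow> real) \<Rightarrow> real \<Rightarrow> profile \<Rightarrow> (nat \<Rightarrow> real set) \<Rightarrow> bool" where
  "surplus_allocation n w z V X \<longleftrightarrow>
     connected_allocation n X \<and> (\<forall>i\<in>{1..n}. V i (X i) > w i + z)"

definition eval_answer :: "(real set \<Rightarrow> real) \<Rightarrow> real \<Rightarrow> real \<Rightarrow> real" where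
  "eval_answer V x y = V {x..y}"

definition mark_answer :: "(real set \<Rightarrow> real) \<Rightarrow> real \<Rightarrow> real \<Rightarrow> ereal" where
  "mark_answer V x r =
     (if V {x..1} < r then \<infinity> else ereal (GREATEST y. y \<in> {x..1} \<and> V {x..y} = r))"

text \<open>
  A deterministic adaptive algorithm is a decision tree: each query node carries the agent and the
  arguments of the query, and a continuation indexed by the answer. Computation between queries
  is free.
\<close>

datatype 'o algorithm =
    Output 'o
  | Eval nat real real "real \<Rightarrow> 'o algorithm"
  | Mark nat real real "ereal \<Rightarrow> 'o algorithm"

primrec run :: "'o algorithm \<Rightarrow> profile \<Rightarrow> 'o" where
  "run (Output out) V = out"
| "run (Eval i x y k) V = run (k (eval_answer (V i) x y)) V"
| "run (Mark i x r k) V = run (k (mark_answer (V i) x r)) V"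

primrec queries :: "'o algorithm \<Rightarrow> profile \<Rightarrow> nat" where
  "queries (Output out) V = 0"
| "queries (Eval i x y k) V = Suc (queries (k (eval_answer (V i) x y)) V)"
| "queries (Mark i x r k) V = Suc (queries (k (mark_answer (V i) x r)) V)"

text \<open>All queries made on the given profile have admissible arguments.\<close>

primrec legal :: "nat \<Rightarrow> 'o algorithm \<Rightarrow> profile \<Rightarrow> bool" where
  "legal n (Output out) V \<longleftrightarrow> True"
| "legal n (Eval i x y k) V \<longleftrightarrow>
     i \<in> {1..n} \<and> 0 \<le> x \<and> x \<le> y \<and> y \<le> 1 \<and> legal n (k (eval_answer (V i) x y)) V"
| "legal n (Mark i x r k) V \<longleftrightarrow>
     i \<in> {1..n} \<and> 0 \<le> x \<and> x \<le> 1 \<and> 0 \<le> r \<and> legal n (k (mark_answer (V i) x r)) V"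

text \<open>
  The fewest queries, in the worst case over the profiles in \<open>P\<close>, with which an algorithm can
  produce an output satisfying the specification \<open>R\<close>; it is \<open>\<infinity>\<close> if no algorithm has a bounded
  number of queries.
\<close>

definition query_complexity :: "nat \<Rightarrow> profile set \<Rightarrow> (profile \<Rightarrow> 'o \<Rightarrow> bool) \<Rightarrow> enat" where
  "query_complexity n P R =
     (INF A \<in> {A. \<forall>V\<in>P. legal n A V \<and> R V (run A V)}. SUP V\<in>P. enat (queries A V))"

definition decides :: "nat \<Rightarrow> (nat \<Rightarrow> real) \<Rightarrow> real \<Rightarrow> profile \<Rightarrow> bool \<Rightarrow> bool" where
  "decides n w z V out \<longleftrightarrow> (out \<longleftrightarrow> (\<exists>X. surplus_allocation n w z V X))"

definition computes :: "nat \<Rightarrow> (nat \<Rightarrow> real) \<Rightarrow> real \<Rightarrow> profile \<Rightarrow> (nat \<Rightarrow> real set) \<Rightarrow> bool" where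
  "computes n w z V out \<longleftrightarrow>
     ((\<exists>X. surplus_allocation n w z V X) \<longrightarrow> surplus_allocation n w z V out)"

text \<open>Entitlements are known to the algorithm, so the algorithm may be chosen depending on them.\<close>

definition decision_complexity :: "nat \<Rightarrow> (nat \<Rightarrow> real) set \<Rightarrow> profile set \<Rightarrow> real \<Rightarrow> enat" where
  "decision_complexity n W P z = (SUP w\<in>W. query_complexity n P (decides n w z))"

definition computation_complexity :: "nat \<Rightarrow> (nat \<Rightarrow> real) set \<Rightarrow> profile set \<Rightarrow> real \<Rightarrow> enat" where
  "computation_complexity n W P z = (SUP w\<in>W. query_complexity n P (computes n w z))"

definition in_Theta :: "(nat \<Rightarrow> enat) \<Rightarrow> (nat \<Rightarrow> real) \<Rightarrow> bool" where
  "in_Theta Q g \<longleftrightarrow> (\<exists>q. (\<forall>n\<ge>2. Q n = enat (q n)) \<and> (\<lambda>n. real (q n)) \<in> \<Theta>(g))"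

end

theory Submission
  imports Defs "HOL-Library.Nat_Bijection"
begin

text \<open>
  Upper bound: serve the agents of a set one after the other from the left, always cutting where
  the current agent reaches exactly her threshold. For every set of agents only the order with the
  leftmost end matters, so dynamic programming over the sets needs one Mark query per set and
  agent in it, and a surplus allocation exists iff the optimal end for all agents is
  smaller than \<open>1\<close>.

  Lower bound: let \<open>r = 1/n + z\<close>, so that \<open>(n - 1) r < 1 < n r\<close>. On an initial segment \<open>[0,b]\<close> agent
  \<open>i < n\<close> has constant density \<open>r / r\<^sub>i\<close>, where the lengths \<open>r\<^sub>i\<close> are slightly below \<open>r\<close>, have distinct
  subset sums and add up to \<open>b\<close>; agent \<open>n\<close> values \<open>[b,1]\<close> at exactly \<open>r\<close>. In every order ending with
  \<open>n\<close> each agent can get exactly \<open>r\<close>, but no allocation gives all of them more. For \<open>i\<close> outside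
  a nonempty set \<open>S\<close> of other agents, lowering the distribution function of agent \<open>i\<close> only near the
  sum of the \<open>r\<^sub>j\<close> with \<open>j\<close> in \<open>S\<close> creates a surplus allocation. A query reveals a distribution function
  at no more than two points, so about \<open>n 2\<^sup>n\<close> queries are needed to exclude all these perturbations.
\<close>

subsection \<open>Valuations and their distribution functions\<close>

lemma interval_in_cake_algebra:
  "is_interval I \<Longrightarrow> I \<subseteq> cake \<Longrightarrow> I \<in> cake_algebra"
  by (auto simp: cake_algebra_def)

text \<open>The Borel subsets of the cake form an algebra containing its intervals, and
  \<open>cake_algebra\<close> is the least one. Hence Borel measures can serve as
  valuations.\<close>

lemma cake_algebra_subset_borel: "cake_algebra \<subseteq> {A. A \<subseteq> cake \<and> A \<in> sets borel}"
proof -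
  have "algebra cake {A. A \<subseteq> cake \<and> A \<in> sets borel}"
    unfolding algebra_iff_Un cake_def by auto
  then show ?thesis
    unfolding cake_algebra_def by (auto intro: real_interval_borel_measurable)
qed

context
  fixes V :: "real set \<Rightarrow> real"
  assumes V: "valuation V"
begin

lemma valuation_nonneg: "is_interval I \<Longrightarrow> I \<subseteq> cake \<Longrightarrow> 0 \<le> V I"
  using V interval_in_cake_algebra unfolding valuation_def by blast

lemma valuation_Un:
  assumes "is_interval I" "is_interval J" "I \<subseteq> cake" "J \<subseteq> cake" "I \<inter> J = {}"
  shows "V (I \<union> J) = V I + V J"
  using V assms interval_in_cake_algebra unfolding valuation_def additive_def by blast

lemma valuation_0 [simp]: "V {0} = 0"
  using V by (simp add: valuation_def)

lemma valuation_1 [simp]: "V {0..1} = 1"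
  using V by (simp add: valuation_def cake_def)

lemma valuation_empty [simp]: "V {} = 0"
  using valuation_Un[of "{}" "{}"] by auto

lemma valuation_continuous: "continuous_on {0..1} (\<lambda>x. V {0..x})"
  using V by (simp add: valuation_def cake_def)

lemma valuation_Ioc:
  assumes "0 \<le> x" "x \<le> y" "y \<le> 1"
  shows "V {x<..y} = V {0..y} - V {0..x}"
proof -
  have "{0..y} = {0..x} \<union> {x<..y}" using assms by auto
  moreover have "V ({0..x} \<union> {x<..y}) = V {0..x} + V {x<..y}"
    using assms by (intro valuation_Un) (auto simp: cake_def is_interval_1)
  ultimately show ?thesis by simp
qed

text \<open>For \<open>x > 0\<close> additivity bounds \<open>V {x}\<close> by
  \<open>V {t<..x}\<close> for every \<open>t < x\<close>, and continuity sends this bound to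
  zero.\<close>

lemma valuation_singleton:
  assumes "0 \<le> x" "x \<le> 1"
  shows "V {x} = 0"
proof (cases "x = 0")
  case False
  then have x: "0 < x" using assms by simp
  have lim: "((\<lambda>t. V {0..x} - V {0..t}) \<longlongrightarrow> V {0..x} - V {0..x}) (at x within {0..<x})"
  proof (intro tendsto_intros)
    have "((\<lambda>t. V {0..t}) \<longlongrightarrow> V {0..x}) (at x within {0..1})"
      using valuation_continuous assms by (auto simp: continuous_on_def)
    then show "((\<lambda>t. V {0..t}) \<longlongrightarrow> V {0..x}) (at x within {0..<x})"
      by (rule tendsto_within_subset) (use assms in auto)
  qed
  have "V {x} \<le> V {0..x} - V {0..t}" if t: "t \<in> {0..<x}" for t
  proof -
    have "{t<..x} = {t<..<x} \<union> {x}" using t by auto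
    moreover have "V ({t<..<x} \<union> {x}) = V {t<..<x} + V {x}"
      using assms t by (intro valuation_Un) (auto simp: cake_def is_interval_1)
    moreover have "0 \<le> V {t<..<x}"
      using assms t by (intro valuation_nonneg) (auto simp: cake_def is_interval_1)
    ultimately show ?thesis using valuation_Ioc[of t x] t assms by simp
  qed
  then have "\<forall>\<^sub>F t in at x within {0..<x}. V {x} \<le> V {0..x} - V {0..t}"
    by (auto simp: eventually_at_filter)
  moreover have "at x within {0..<x} \<noteq> bot"
    using x by (simp add: at_within_eq_bot_iff)
  ultimately have "V {x} \<le> V {0..x} - V {0..x}"
    using lim tendsto_lowerbound by blast
  moreover have "0 \<le> V {x}"
    using assms by (intro valuation_nonneg) (auto simp: cake_def is_interval_1)
  ultimately show ?thesis by simp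
qed simp

text \<open>Points are worthless, so every Eval answer is a difference of two values of the
  distribution function.\<close>

lemma valuation_Icc:
  assumes "0 \<le> x" "x \<le> y" "y \<le> 1"
  shows "V {x..y} = V {0..y} - V {0..x}"
proof -
  have "{x..y} = {x} \<union> {x<..y}" using assms by auto
  moreover have "V ({x} \<union> {x<..y}) = V {x} + V {x<..y}"
    using assms by (intro valuation_Un) (auto simp: cake_def is_interval_1)
  ultimately show ?thesis using valuation_Ioc valuation_singleton assms by simp
qed

lemma valuation_mono:
  assumes "0 \<le> x" "x \<le> y" "y \<le> 1"
  shows "V {0..x} \<le> V {0..y}"
proof -
  have "0 \<le> V {x..y}"
    using assms by (intro valuation_nonneg) (auto simp: cake_def is_interval_1)
  then show ?thesis using valuation_Icc[of x y] assms by simp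
qed

lemma hungry_strict_mono:
  assumes "hungry V" "0 \<le> x" "x < y" "y \<le> 1"
  shows "V {0..x} < V {0..y}"
proof -
  have "0 < V {x..y}"
    using assms unfolding hungry_def by (auto simp: cake_def is_interval_1)
  then show ?thesis using valuation_Icc[of x y] assms by simp
qed

section \<open>Answers to Mark queries\<close>

lemma mark_answer_cases:
  assumes "0 \<le> x" "x \<le> 1" "0 \<le> r"
  obtains (infinite) "V {0..1} - V {0..x} < r" "mark_answer V x r = \<infinity>"
  | (finite) m where "mark_answer V x r = ereal m" "x \<le> m" "m \<le> 1"
      "V {0..m} = V {0..x} + r"
      "\<And>y. m < y \<Longrightarrow> y \<le> 1 \<Longrightarrow> V {0..x} + r < V {0..y}"
proof (cases "V {x..1} < r")
  case True
  then show ?thesis using infinite valuation_Icc[of x 1] assms by (simp add: mark_answer_def)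
next
  case False
  \<comment> \<open>This level set is nonempty by the intermediate value theorem and compact by
    continuity, so it has a largest point, the answer.\<close>
  define K where "K = {y \<in> {x..1}. V {0..y} = V {0..x} + r}"
  have cont: "continuous_on {x..1} (\<lambda>y. V {0..y})"
    using valuation_continuous by (rule continuous_on_subset) (use assms in auto)
  have "\<exists>y\<ge>x. y \<le> 1 \<and> V {0..y} = V {0..x} + r"
    using False assms valuation_Icc[of x 1] by (intro IVT' cont) auto
  then have "K \<noteq> {}" by (auto simp: K_def)
  moreover have "closed K"
    unfolding K_def by (intro continuous_closed_preimage_constant cont) simp
  then have "compact K"
    by (auto simp: compact_eq_bounded_closed K_def intro: bounded_subset[of "{x..1}"])
  ultimately obtain m where m: "m \<in> K" "\<And>y. y \<in> K \<Longrightarrow> y \<le> m"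
    using compact_attains_sup by metis
  have "(GREATEST y. y \<in> {x..1} \<and> V {x..y} = r) = m"
    using m valuation_Icc[of x] assms by (intro Greatest_equality) (auto simp: K_def)
  then have M: "mark_answer V x r = ereal m" using False by (simp add: mark_answer_def)
  have above: "V {0..x} + r < V {0..y}" if "m < y" "y \<le> 1" for y
  proof -
    have "V {0..m} \<le> V {0..y}" using m(1) that assms by (intro valuation_mono) (auto simp: K_def)
    moreover have "V {0..y} \<noteq> V {0..x} + r"
      using m(2)[of y] m(1) that by (auto simp: K_def)
    ultimately show ?thesis using m(1) by (auto simp: K_def)
  qed
  show ?thesis using finite[OF M _ _ _ above] m(1) by (auto simp: K_def)
qed

lemma mark_answer_ge:
  assumes "0 \<le> x" "x \<le> 1" "0 \<le> r"
  shows "ereal x \<le> mark_answer V x r"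
  using assms by (cases rule: mark_answer_cases) auto

text \<open>Mark returns the largest point reaching the target, so the target is strictly exceeded
  beyond it. Strict surplus thereby becomes a strict comparison of cuts.\<close>

lemma mark_answer_less_iff:
  assumes "0 \<le> x" "x \<le> y" "y \<le> 1" "0 \<le> r"
  shows "mark_answer V x r < ereal y \<longleftrightarrow> r < V {x..y}"
proof -
  have "x \<le> 1" using assms by simp
  with assms(1) show ?thesis
    using assms(4)
  proof (cases rule: mark_answer_cases)
    case infinite
    then show ?thesis
      using valuation_Icc[of x y] valuation_mono[of y 1] assms by auto
  next
    case (finite m)
    then show ?thesis
      using valuation_Icc[of x y] valuation_mono[of y m] assms
      by (cases "m < y") (fastforce dest: finite(5))+
  qed
qed

text \<open>Moving the start to the right can only raise the level \<open>V {0..x} + r\<close> that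
  the distribution function has to reach.\<close>

lemma mark_answer_mono:
  assumes "0 \<le> x" "x \<le> y" "y \<le> 1" "0 \<le> r"
  shows "mark_answer V x r \<le> mark_answer V y r"
proof (rule ccontr)
  assume less: "\<not> ?thesis"
  have y: "0 \<le> y" using assms by simp
  from y assms(3,4) show False
  proof (cases rule: mark_answer_cases)
    case (finite m)
    have x: "x \<le> 1" using assms by simp
    from assms(1) x assms(4) show False
    proof (cases rule: mark_answer_cases)
      case infinite
      then show False
        using finite valuation_mono[of x y] valuation_mono[of m 1] assms by auto
    next
      case (finite m')
      then have "m < m'" using less \<open>mark_answer V y r = ereal m\<close> by simp
      then show False
        using finite \<open>V {0..m} = _\<close> valuation_mono[of x y] assms
          \<open>\<And>u. m < u \<Longrightarrow> u \<le> 1 \<Longrightarrow> V {0..y} + r < V {0..u}\<close>[of m'] by auto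
    qed
  qed (use less in auto)
qed

end

text \<open>A hungry \<open>V'\<close> reaches the target at only one point, so the values at the
  start and at the answer fix a finite answer. An infinite one is fixed by the value at the start,
  the total being \<open>1\<close>.\<close>

lemma mark_answer_cong:
  assumes V: "valuation V" and V': "valuation V'" "hungry V'"
    and x: "0 \<le> x" "x \<le> 1" "0 \<le> r" "V' {0..x} = V {0..x}"
    and ans: "V' {0..real_of_ereal (mark_answer V x r)} = V {0..real_of_ereal (mark_answer V x r)}"
  shows "mark_answer V' x r = mark_answer V x r"
  using V x(1-3)
proof (cases rule: mark_answer_cases)
  case infinite
  then show ?thesis
    using x V V' valuation_Icc[OF V'(1), of x 1] by (simp add: mark_answer_def)
next
  case fin: (finite m)
  from V'(1) x(1-3) show ?thesis
  proof (cases rule: mark_answer_cases)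
    case infinite
    then show ?thesis
      using fin x V V' ans valuation_mono[OF V, of m 1] by simp
  next
    case (finite m')
    then show ?thesis
      using fin x ans hungry_strict_mono[OF V', of m m'] hungry_strict_mono[OF V', of m' m]
      by (cases m m' rule: linorder_cases) auto
  qed
qed

text \<open>The Stieltjes measure of \<open>F\<close> is hungry since an interval of positive length
  contains some \<open>{a..b}\<close> with \<open>a < b\<close>, worth
  \<open>F b - F a > 0\<close>.\<close>

lemma valuation_interval_measure:
  fixes F :: "real \<Rightarrow> real"
  assumes F: "strict_mono F" "continuous_on UNIV F" "F 0 = 0" "F 1 = 1"
  shows "valuation (measure (interval_measure F))" "hungry (measure (interval_measure F))"
    "0 \<le> x \<Longrightarrow> measure (interval_measure F) {0..x} = F x"
proof -
  define M where "M = interval_measure F"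
  have mono: "\<And>x y. x \<le> y \<Longrightarrow> F x \<le> F y" using F(1) by (simp add: strict_mono_less_eq)
  have Icc: "emeasure M {a..b} = F b - F a" if "a \<le> b" for a b
    unfolding M_def using that mono F(2) by (rule emeasure_interval_measure_Icc)
  have Icc': "measure M {a..b} = F b - F a" if "a \<le> b" for a b
    using Icc[OF that] mono[OF that] by (simp add: measure_def)
  \<comment> \<open>Additivity and monotonicity of \<open>measure\<close> are available on sets of
    finite measure; the cake has measure \<open>1\<close>.\<close>
  have fin: "A \<in> fmeasurable M" if "A \<in> sets borel" "A \<subseteq> cake" for A
    by (rule fmeasurableI2[of "{0..1}"]) (use that Icc[of 0 1] in \<open>auto simp: cake_def M_def intro!: fmeasurableI\<close>)
  show *: "measure (interval_measure F) {0..x} = F x" if "0 \<le> x" for x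
    using Icc'[of 0 x] that F by (simp add: M_def)
  have "additive cake_algebra (measure M)"
    unfolding additive_def using cake_algebra_subset_borel fin
    by (auto intro!: measure_Un3[THEN trans] simp: subset_iff)
  moreover have "continuous_on cake (\<lambda>x. measure M {0..x})"
    by (rule continuous_on_eq[of _ F])
       (use Icc'[of 0] F continuous_on_subset[OF F(2)] in \<open>auto simp: cake_def\<close>)
  ultimately show "valuation (measure (interval_measure F))"
    unfolding valuation_def M_def[symmetric]
    using Icc'[of 0 0] Icc'[of 0 1] F(3,4) by (simp add: cake_def)
  show "hungry (measure (interval_measure F))"
    unfolding hungry_def M_def[symmetric]
  proof (intro allI impI)
    fix X assume X: "is_interval X" "X \<subseteq> cake" "0 < measure lborel X"
    have "\<exists>a\<in>X. \<exists>b\<in>X. a < b"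
    proof (rule ccontr)
      assume "\<not> ?thesis"
      then have "X = {} \<or> (\<exists>a. X = {a})" 
        by (metis is_singletonE is_singletonI' linorder_neq_iff)
      then show False using X(3) by auto
    qed
    then obtain a b where ab: "a \<in> X" "b \<in> X" "a < b" by blast
    have "{a..b} \<subseteq> X"
      using X(1) ab(1,2) unfolding is_interval_1 atLeastAtMost_iff subset_iff by blast
    then have "measure M {a..b} \<le> measure M X"
      using fin[OF real_interval_borel_measurable] X
      by (intro measure_mono_fmeasurable) (auto simp: M_def)
    moreover have "0 < measure M {a..b}"
      using Icc'[of a b] ab strict_monoD[OF F(1)] by simp
    ultimately show "0 < measure M X" by simp
  qed
qed

subsection \<open>Solving a specification with boundedly many queries\<close>

primrec bind_algorithm :: "'a algorithm \<Rightarrow> ('a \<Rightarrow> 'b algorithm) \<Rightarrow> 'b algorithm" where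
  "bind_algorithm (Output a) f = f a"
| "bind_algorithm (Eval i x y k) f = Eval i x y (\<lambda>e. bind_algorithm (k e) f)"
| "bind_algorithm (Mark i x r k) f = Mark i x r (\<lambda>e. bind_algorithm (k e) f)"

lemma run_bind: "run (bind_algorithm A f) V = run (f (run A V)) V"
  by (induction A) auto

lemma queries_bind: "queries (bind_algorithm A f) V = queries A V + queries (f (run A V)) V"
  by (induction A) auto

lemma legal_bind: "legal n (bind_algorithm A f) V \<longleftrightarrow> legal n A V \<and> legal n (f (run A V)) V"
  by (induction A) auto

text \<open>A budget \<open>q\<close> instead of an exact count and a set \<open>P\<close> of
  profiles still possible let algorithms be composed without writing them down.\<close>

definition solves :: "nat \<Rightarrow> profile set \<Rightarrow> nat \<Rightarrow> (profile \<Rightarrow> 'o \<Rightarrow> bool) \<Rightarrow> bool" where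
  "solves n P q R \<longleftrightarrow> (\<exists>A. \<forall>V\<in>P. legal n A V \<and> R V (run A V) \<and> queries A V \<le> q)"

lemma solves_output: "(\<And>V. V \<in> P \<Longrightarrow> R V out) \<Longrightarrow> solves n P q R"
  unfolding solves_def by (rule exI[of _ "Output out"]) auto

lemma solves_empty: "solves n {} q R"
  by (simp add: solves_def)

lemma solves_eval:
  assumes "P \<noteq> {} \<Longrightarrow> i \<in> {1..n} \<and> 0 \<le> x \<and> x \<le> y \<and> y \<le> 1"
  shows "solves n P 1 (\<lambda>V e. e = V i {x..y})"
  unfolding solves_def
  by (rule exI[of _ "Eval i x y Output"]) (use assms in \<open>auto simp: eval_answer_def\<close>)

lemma solves_mark:
  assumes "P \<noteq> {} \<Longrightarrow> i \<in> {1..n} \<and> 0 \<le> x \<and> x \<le> 1 \<and> 0 \<le> r"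
  shows "solves n P 1 (\<lambda>V e. e = mark_answer (V i) x r)"
  unfolding solves_def by (rule exI[of _ "Mark i x r Output"]) (use assms in auto)

text \<open>The intermediate output narrows the profiles to those consistent with it; a continuation
  for each output is picked by choice.\<close>

lemma solves_bind:
  assumes R: "solves n P q R"
    and R': "\<And>out. solves n {V \<in> P. R V out} q' R'"
    and le: "q + q' \<le> q''"
  shows "solves n P q'' R'"
proof -
  obtain A where A: "\<forall>V\<in>P. legal n A V \<and> R V (run A V) \<and> queries A V \<le> q"
    using R by (auto simp: solves_def)
  have "\<exists>B. \<forall>out. \<forall>V\<in>{V \<in> P. R V out}.
      legal n (B out) V \<and> R' V (run (B out) V) \<and> queries (B out) V \<le> q'"
    using R' unfolding solves_def by (intro choice allI)
  then obtain B where B: "\<And>out V. V \<in> P \<Longrightarrow> R V out \<Longrightarrow>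
      legal n (B out) V \<and> R' V (run (B out) V) \<and> queries (B out) V \<le> q'"
    by blast
  show ?thesis
    unfolding solves_def
    by (rule exI[of _ "bind_algorithm A B"])
       (use A B le in \<open>fastforce simp: run_bind queries_bind legal_bind intro: add_mono order_trans\<close>)
qed

lemma solves_map:
  assumes "solves n P q R" "\<And>V out. V \<in> P \<Longrightarrow> R V out \<Longrightarrow> R' V (f out)" "q \<le> q'"
  shows "solves n P q' R'"
  by (rule solves_bind[OF assms(1), where q' = 0])
     (auto intro: solves_output[where out = "f _"] assms)

lemma solves_family:
  assumes "finite I" "\<And>i. i \<in> I \<Longrightarrow> solves n P c (R i)"
  shows "solves n P (c * card I) (\<lambda>V u. \<forall>i\<in>I. R i V (u i))"
  using assms
proof (induction I rule: finite_induct)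
  case empty
  then show ?case by (auto intro: solves_output)
next
  case (insert j I)
  have "solves n P (c * card I) (\<lambda>V u. \<forall>i\<in>I. R i V (u i))"
    using insert by auto
  then show ?case
  proof (rule solves_bind)
    fix u
    let ?P = "{V \<in> P. \<forall>i\<in>I. R i V (u i)}"
    have "solves n ?P c (R j)"
      by (rule solves_bind[OF solves_output[where R = "\<lambda>_ _. True" and q = 0]])
         (use insert.prems[of j] in \<open>auto simp: solves_def\<close>)
    then show "solves n ?P c (\<lambda>V u. \<forall>i\<in>insert j I. R i V (u i))"
      by (rule solves_map[where f = "\<lambda>v. u(j := v)"]) (use insert.hyps in auto)
  qed (use insert.hyps in auto)
qed

lemma query_complexity_le:
  assumes "solves n P q R"
  shows "query_complexity n P R \<le> enat q"
  using assms unfolding solves_def query_complexity_def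
  by (auto intro!: INF_lower2 SUP_least)

lemma query_complexity_ge:
  assumes "V \<in> P" "\<And>A. (\<And>V. V \<in> P \<Longrightarrow> legal n A V \<and> R V (run A V)) \<Longrightarrow> q \<le> queries A V"
  shows "enat q \<le> query_complexity n P R"
  unfolding query_complexity_def using assms
  by (intro INF_greatest SUP_upper2[of V]) auto

lemma query_complexity_mono:
  "P \<subseteq> P' \<Longrightarrow> query_complexity n P R \<le> query_complexity n P' R"
  unfolding query_complexity_def by (intro INF_mono) (auto intro!: SUP_subset_mono)

subsection \<open>Greedy prefixes\<close>

text \<open>\<open>\<infinity>\<close> marks a prefix that could not be served. It has to persist:
  \<open>real_of_ereal \<infinity>\<close> is \<open>0\<close>, so a query from it would restart at
  the left end of the cake.\<close>

definition next_mark :: "(nat \<Rightarrow> real) \<Rightarrow> profile \<Rightarrow> nat \<Rightarrow> ereal \<Rightarrow> ereal" where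
  "next_mark r V i x = (if x = \<infinity> then \<infinity> else mark_answer (V i) (real_of_ereal x) (r i))"

text \<open>The agents are served from left to right, the head of the list being served last.\<close>

primrec greedy_end :: "(nat \<Rightarrow> real) \<Rightarrow> profile \<Rightarrow> nat list \<Rightarrow> ereal" where
  "greedy_end r V [] = 0"
| "greedy_end r V (i # s) = next_mark r V i (greedy_end r V s)"

definition cake_points :: "ereal set" where
  "cake_points = insert \<infinity> (ereal ` {0..1})"

text \<open>The invariant of the construction of pieces. A point \<open>c\<close> separating two
  pieces expresses disjointness up to endpoints.\<close>

definition chain_pieces ::
    "(nat \<Rightarrow> real) \<Rightarrow> profile \<Rightarrow> nat list \<Rightarrow> real \<Rightarrow> (nat \<Rightarrow> real set) \<Rightarrow> bool" where
  "chain_pieces r V s y X \<longleftrightarrow>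
     (\<forall>i\<in>set s. \<exists>a b. X i = {a..b} \<and> 0 \<le> a \<and> a < b \<and> b \<le> y) \<and>
     (\<Union>i\<in>set s. X i) = {0..y} \<and>
     (\<forall>i\<in>set s. r i < V i (X i)) \<and>
     (\<forall>i\<in>set s. \<forall>j\<in>set s. i \<noteq> j \<longrightarrow>
        (\<exists>c. X i \<subseteq> {..c} \<and> X j \<subseteq> {c..} \<or> X j \<subseteq> {..c} \<and> X i \<subseteq> {c..}))"

lemma next_mark_cake_points:
  assumes "valuation (V i)" "0 \<le> r i" "x \<in> cake_points"
  shows "next_mark r V i x \<in> cake_points"
  using assms(3) unfolding cake_points_def next_mark_def
proof (clarsimp split: if_splits)
  fix u :: real assume "0 \<le> u" "u \<le> 1" "mark_answer (V i) u (r i) \<notin> ereal ` {0..1}"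
  then show "mark_answer (V i) u (r i) = \<infinity>"
    by (cases rule: mark_answer_cases[OF assms(1) _ _ assms(2), of u]) auto
qed

lemma greedy_end_cake_points:
  assumes "\<And>i. i \<in> set s \<Longrightarrow> valuation (V i) \<and> 0 \<le> r i"
  shows "greedy_end r V s \<in> cake_points"
  using assms
proof (induction s)
  case Nil
  then show ?case by (simp add: cake_points_def zero_ereal_def)
qed (simp add: next_mark_cake_points)

lemma next_mark_mono:
  assumes "valuation (V i)" "0 \<le> r i" "x \<in> cake_points" "y \<in> cake_points" "x \<le> y"
  shows "next_mark r V i x \<le> next_mark r V i y"
  using assms by (auto simp: cake_points_def next_mark_def intro!: mark_answer_mono)

lemma next_mark_less:
  assumes "valuation (V i)" "0 \<le> r i" "x \<in> cake_points" "x \<le> ereal a"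
    "a \<le> b" "b \<le> 1" "r i < V i {a..b}"
  shows "next_mark r V i x < ereal b"
proof -
  from assms(3,4) have a: "0 \<le> a"
    by (auto simp: cake_points_def)
  have "next_mark r V i x \<le> next_mark r V i (ereal a)"
    using assms a by (intro next_mark_mono) (auto simp: cake_points_def)
  also have "\<dots> < ereal b"
    using assms a by (simp add: next_mark_def mark_answer_less_iff)
  finally show ?thesis .
qed

lemma surplus_allocation_chain_pieces:
  assumes "chain_pieces (\<lambda>i. w i + z) V s 1 X" "set s = {1..n}"
  shows "surplus_allocation n w z V X"
proof -
  have iv: "\<exists>a b. X i = {a..b} \<and> a < b" if "i \<in> {1..n}" for i
    using assms that unfolding chain_pieces_def by blast
  have fr: "X i \<inter> X j \<subseteq> frontier (X i) \<inter> frontier (X j)"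
    if ij: "i \<in> {1..n}" "j \<in> {1..n}" "i \<noteq> j" for i j
  proof -
    obtain a b a' b' where ab: "X i = {a..b}" "a < b" "X j = {a'..b'}" "a' < b'"
      using iv ij by meson
    obtain c where "X i \<subseteq> {..c} \<and> X j \<subseteq> {c..} \<or> X j \<subseteq> {..c} \<and> X i \<subseteq> {c..}"
      using assms(1) ij unfolding chain_pieces_def assms(2) by blast
    then have "b \<le> a' \<or> b' \<le> a" using ab by auto
    then show ?thesis using ab by (auto simp: frontier_def)
  qed
  have un: "\<exists>K. finite K \<and> (\<forall>I\<in>K. \<exists>a b. a \<le> b \<and> I = {a..b}) \<and> X i = \<Union>K"
    if "i \<in> {1..n}" for i
    using iv[OF that] by (intro exI[of _ "{X i}"]) (auto intro: less_imp_le)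
  have "(\<Union>i\<in>{1..n}. X i) = cake"
    using assms unfolding chain_pieces_def cake_def by simp
  then have "allocation n X"
    unfolding allocation_def by (intro conjI ballI impI fr un)
  moreover have "\<forall>i\<in>{1..n}. w i + z < V i (X i)"
    using assms unfolding chain_pieces_def by blast
  moreover have "\<forall>i\<in>{1..n}. \<exists>a b. X i = {a..b}"
    using iv by blast
  ultimately show ?thesis
    by (simp only: surplus_allocation_def connected_allocation_def)
qed

text \<open>Positive thresholds rule out empty and one-point pieces, which are worth nothing.
  Overlapping pieces would share the midpoint of their overlap, an interior point, against the
  frontier condition.\<close>

lemma surplus_allocation_intervals:
  assumes X: "surplus_allocation n w z V X"
    and V: "V \<in> all_profiles n"
    and r: "\<And>i. i \<in> {1..n} \<Longrightarrow> 0 < w i + z"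
  obtains a b where "\<And>i. i \<in> {1..n} \<Longrightarrow>
      X i = {a i..b i} \<and> 0 \<le> a i \<and> a i < b i \<and> b i \<le> 1 \<and> w i + z < V i {a i..b i}"
    "\<And>i j. i \<in> {1..n} \<Longrightarrow> j \<in> {1..n} \<Longrightarrow> i \<noteq> j \<Longrightarrow> b i \<le> a j \<or> b j \<le> a i"
proof -
  have "\<forall>i\<in>{1..n}. \<exists>a b. X i = {a..b} \<and> 0 \<le> a \<and> a < b \<and> b \<le> 1 \<and> w i + z < V i {a..b}"
  proof
    fix i assume i: "i \<in> {1..n}"
    then have val: "valuation (V i)" using V by (simp add: all_profiles_def)
    obtain a b where ab: "X i = {a..b}" "w i + z < V i {a..b}"
      using X i unfolding surplus_allocation_def connected_allocation_def by metis
    have "(\<Union>i\<in>{1..n}. X i) = {0..1}"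
      using X by (simp add: surplus_allocation_def connected_allocation_def allocation_def cake_def)
    then have sub: "X i \<subseteq> {0..1}" using i by blast
    have "a < b"
    proof (rule ccontr)
      assume "\<not> a < b"
      then consider "b < a" | "a = b" by linarith
      then have "V i {a..b} = 0"
      proof cases
        case 1
        then show ?thesis using valuation_empty[OF val] by simp
      next
        case 2
        then show ?thesis using valuation_singleton[OF val] sub ab by auto
      qed
      then show False using ab r[OF i] by simp
    qed
    then show "\<exists>a b. X i = {a..b} \<and> 0 \<le> a \<and> a < b \<and> b \<le> 1 \<and> w i + z < V i {a..b}"
      using ab sub by (intro exI[of _ a] exI[of _ b]) auto
  qed
  then obtain a b where ab: "\<And>i. i \<in> {1..n} \<Longrightarrow>
      X i = {a i..b i} \<and> 0 \<le> a i \<and> a i < b i \<and> b i \<le> 1 \<and> w i + z < V i {a i..b i}"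
    by metis
  have "b i \<le> a j \<or> b j \<le> a i" if ij: "i \<in> {1..n}" "j \<in> {1..n}" "i \<noteq> j" for i j
  proof (rule ccontr)
    assume neg: "\<not> ?thesis"
    let ?l = "max (a i) (a j)" and ?u = "min (b i) (b j)"
    have lu: "?l < ?u" using neg ab[OF ij(1)] ab[OF ij(2)] by auto
    have "X i \<inter> X j \<subseteq> frontier (X i)"
      using X ij by (simp add: surplus_allocation_def connected_allocation_def allocation_def)
    moreover have "(?l + ?u) / 2 \<in> X i \<inter> X j"
      using ab[OF ij(1)] ab[OF ij(2)] lu by (auto simp: field_simps)
    moreover have "(?l + ?u) / 2 \<notin> frontier (X i)"
      using ab[OF ij(1)] lu by (auto simp: frontier_def field_simps)
    ultimately show False by blast
  qed
  with ab that show ?thesis by blast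
qed

text \<open>The entry for \<open>S\<close> in the table of the dynamic program. The order is stored
  with its end because the pieces are later cut along it.\<close>

definition optimal_order :: "(nat \<Rightarrow> real) \<Rightarrow> profile \<Rightarrow> nat set \<Rightarrow> nat list \<times> ereal \<Rightarrow> bool" where
  "optimal_order r V S = (\<lambda>(s, e). set s = S \<and> distinct s \<and> e = greedy_end r V s \<and>
     (\<forall>t. set t = S \<longrightarrow> distinct t \<longrightarrow> e \<le> greedy_end r V t))"

section \<open>Building pieces and optimal orders with few queries\<close>

context
  fixes n :: nat and r :: "nat \<Rightarrow> real" and P :: "profile set"
  assumes r: "\<And>i. i \<in> {1..n} \<Longrightarrow> 0 < r i"
    and P: "P \<subseteq> all_profiles n"
begin

lemma valuation_agent: "V \<in> P \<Longrightarrow> i \<in> {1..n} \<Longrightarrow> valuation (V i)"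
  using P by (auto simp: all_profiles_def)

lemma greedy_end_agents:
  "V \<in> P \<Longrightarrow> set s \<subseteq> {1..n} \<Longrightarrow> greedy_end r V s \<in> cake_points"
  by (rule greedy_end_cake_points) (use valuation_agent less_imp_le[OF r] in auto)

lemma solves_next_mark:
  assumes "i \<in> {1..n}" "P' \<subseteq> P" "x \<in> cake_points"
  shows "solves n P' 1 (\<lambda>V e. e = next_mark r V i x)"
proof (cases "x = \<infinity>")
  case True
  then show ?thesis by (auto simp: next_mark_def intro: solves_output)
next
  case False
  then obtain u where "x = ereal u" "0 \<le> u" "u \<le> 1"
    using assms by (auto simp: cake_points_def)
  then show ?thesis
    using solves_mark[of P' i n u "r i"] assms r[of i] by (simp add: next_mark_def less_imp_le)
qed

lemma solves_greedy_end:
  assumes "set s \<subseteq> {1..n}" "P' \<subseteq> P"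
  shows "solves n P' (length s) (\<lambda>V e. e = greedy_end r V s)"
  using assms
proof (induction s)
  case Nil
  then show ?case by (auto intro: solves_output)
next
  case (Cons i s)
  have "solves n P' (length s) (\<lambda>V e. e = greedy_end r V s)"
    using Cons by simp
  then show ?case
  proof (rule solves_bind)
    fix e
    let ?Q = "{V \<in> P'. e = greedy_end r V s}"
    show "solves n ?Q 1 (\<lambda>V e. e = greedy_end r V (i # s))"
    proof (cases "?Q = {}")
      case False
      then have "e \<in> cake_points" using greedy_end_agents Cons.prems by auto
      then have "solves n ?Q 1 (\<lambda>V u. u = next_mark r V i e)"
        using Cons.prems by (intro solves_next_mark) auto
      then show ?thesis by (rule solves_map[where f = id]) auto
    qed (simp only: solves_empty)
  qed simp
qed

text \<open>
  The pieces are cut from right to left. If the head agent receives more than her threshold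
  between the greedy end \<open>g\<close> of the others and \<open>y\<close>, then giving half of her surplus away moves her
  left cut strictly to the right of \<open>g\<close>, so that the same situation recurs for the other agents.
\<close>

lemma solves_chain_pieces:
  assumes "s \<noteq> []" "set s \<subseteq> {1..n}" "distinct s" "y \<le> 1"
    "P' \<subseteq> {V \<in> P. greedy_end r V s < ereal y}"
  shows "solves n P' (length s * (length s + 2)) (\<lambda>V X. chain_pieces r V s y X)"
  using assms
proof (induction s arbitrary: y P' rule: list_nonempty_induct)
  case (single i)
  have "chain_pieces r V [i] y (\<lambda>_. {0..y})" if "V \<in> P'" for V
  proof -
    have V: "valuation (V i)" "0 < r i" using that single.prems valuation_agent r by auto
    have M: "mark_answer (V i) 0 (r i) < ereal y"
      using that single.prems by (auto simp: next_mark_def)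
    have "ereal 0 \<le> mark_answer (V i) 0 (r i)"
      using V by (intro mark_answer_ge) auto
    with M have y: "0 < y" using ereal_less(1) le_less_trans by fastforce
    with M V single.prems have "r i < V i {0..y}" by (subst (asm) mark_answer_less_iff) auto
    with y show ?thesis by (auto simp: chain_pieces_def)
  qed
  then show ?case by (intro solves_output)
next
  case (cons i s)
  have i: "i \<in> {1..n}" and ri: "0 < r i" using cons.prems r by auto
  \<comment> \<open>Recomputing the end of the other agents takes \<open>length s\<close> queries,
    and the cut one Eval and one Mark; over all agents this is quadratic.\<close>
  have "solves n P' (length s) (\<lambda>V e. e = greedy_end r V s)"
    using cons.prems by (intro solves_greedy_end) auto
  then show ?case
  proof (rule solves_bind)
    fix e
    let ?Q = "{V \<in> P'. e = greedy_end r V s}"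
    let ?q = "length s * (length s + 2)"
    show "solves n ?Q (2 + ?q) (\<lambda>V X. chain_pieces r V (i # s) y X)"
    proof (cases "?Q = {}")
      case False
      \<comment> \<open>All remaining profiles share the answer \<open>e\<close>, so any one of them
        shows what \<open>e\<close> can be.\<close>
      then obtain V0 where V0: "V0 \<in> ?Q" by blast
      then have "e \<in> cake_points" "e \<noteq> \<infinity>"
        using greedy_end_agents[of V0 s] cons.prems by (auto simp: next_mark_def)
      then obtain g where e: "e = ereal g" and g: "0 \<le> g" "g \<le> 1"
        by (auto simp: cake_points_def)
      have M: "mark_answer (V i) g (r i) < ereal y" if "V \<in> ?Q" for V
      proof -
        have "greedy_end r V (i # s) < ereal y" "greedy_end r V s = ereal g"
          using that cons.prems e by auto
        then show ?thesis by (simp add: next_mark_def)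
      qed
      have val: "valuation (V i)" if "V \<in> ?Q" for V
        using that cons.prems i valuation_agent by auto
      have gy: "g < y"
        using M[OF V0] mark_answer_ge[OF val[OF V0] g, of "r i"] ri
          by (metis le_less_trans less_ereal.simps(1) less_imp_le)
      have sur: "r i < V i {g..y}" if "V \<in> ?Q" for V
        using M[OF that] val[OF that] g gy cons.prems ri by (subst (asm) mark_answer_less_iff) auto
      have "solves n ?Q 1 (\<lambda>V v. v = V i {g..y})"
        by (rule solves_eval) (use i g gy cons.prems in auto)
      then show ?thesis
      proof (rule solves_bind)
        fix v
        let ?Q' = "{V \<in> ?Q. v = V i {g..y}}"
        have v: "r i < v" if "?Q' \<noteq> {}" using that sur by auto
        have "solves n ?Q' 1 (\<lambda>V u. u = mark_answer (V i) g ((v - r i) / 2))"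
          by (rule solves_mark) (use i g v in auto)
        then show "solves n ?Q' (1 + ?q) (\<lambda>V X. chain_pieces r V (i # s) y X)"
        proof (rule solves_bind)
          fix u
          let ?R = "{V \<in> ?Q'. u = mark_answer (V i) g ((v - r i) / 2)}"
          show "solves n ?R ?q (\<lambda>V X. chain_pieces r V (i # s) y X)"
          proof (cases "?R = {}")
            case False
            then have v: "r i < v" using v by auto
            have u: "\<exists>x. u = ereal x \<and> g < x \<and> x < y \<and> r i < V i {x..y}" if "V \<in> ?R" for V
            proof -
              have V: "valuation (V i)" "v = V i {g..y}" "u = mark_answer (V i) g ((v - r i) / 2)"
                using that val by auto
              have "mark_answer (V i) g ((v - r i) / 2) < ereal y"
                using mark_answer_less_iff[OF V(1), of g y "(v - r i) / 2"] V(2) v ri g gy cons.prems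
                by auto
              have "0 \<le> (v - r i) / 2" using v by simp
              with V(1) g show ?thesis
              proof (cases rule: mark_answer_cases)
                case (finite m)
                then have m: "u = ereal m" "m < y"
                  using V \<open>mark_answer (V i) g ((v - r i) / 2) < ereal y\<close> by auto
                \<comment> \<open>The positive target moves the cut off \<open>g\<close>, while
                  agent \<open>i\<close> keeps \<open>(v + r i) / 2\<close>, still more than
                  \<open>r i\<close>.\<close>
                have "m \<noteq> g" using finite v by auto
                moreover have "V i {m..y} = v - (v - r i) / 2"
                  using finite m g gy cons.prems V(2)
                    valuation_Icc[OF V(1), of m y] valuation_Icc[OF V(1), of g y] by auto
                then have "r i < V i {m..y}" using v by (simp add: field_simps)
                ultimately show ?thesis using finite m by auto
              qed (use \<open>mark_answer (V i) g ((v - r i) / 2) < ereal y\<close> in auto)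
            qed
            with False obtain x where x: "u = ereal x" "g < x" "x < y" by blast
            have surx: "r i < V i {x..y}" if "V \<in> ?R" for V using u[OF that] x by auto
            have "solves n ?R ?q (\<lambda>V X. chain_pieces r V s x X)"
            proof (rule cons.IH)
              show "?R \<subseteq> {V \<in> P. greedy_end r V s < ereal x}"
              proof
                fix V assume "V \<in> ?R"
                then have "V \<in> P" "greedy_end r V s = ereal g" using cons.prems e by auto
                then show "V \<in> {V \<in> P. greedy_end r V s < ereal x}" using x by simp
              qed
            qed (use cons.prems x in auto)
            then show ?thesis
            proof (rule solves_map[where f = "\<lambda>X. X(i := {x..y})"])
              fix V X assume VX: "V \<in> ?R" "chain_pieces r V s x X"
              have "i \<notin> set s" using cons.prems by simp
              then have X: "(X(i := {x..y})) j = (if j = i then {x..y} else X j)" for j by simp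
              have un: "(\<Union>j\<in>set s. X j) = {0..x}" using VX(2) by (simp add: chain_pieces_def)
              then have below: "X j \<subseteq> {..x}" if "j \<in> set s" for j using that by fastforce
              have "(\<Union>j\<in>set (i # s). (X(i := {x..y})) j) = {x..y} \<union> (\<Union>j\<in>set s. X j)"
                using \<open>i \<notin> set s\<close> by (auto split: if_splits)
              also have "\<dots> = {0..y}" using un x g by auto
              finally have un': "(\<Union>j\<in>set (i # s). (X(i := {x..y})) j) = {0..y}" .
              have iv: "\<exists>a b. (X(i := {x..y})) j = {a..b} \<and> 0 \<le> a \<and> a < b \<and> b \<le> y"
                if "j \<in> set (i # s)" for j
              proof (cases "j = i")
                case False
                then have "j \<in> set s" using that by simp
                then obtain a b where "X j = {a..b} \<and> 0 \<le> a \<and> a < b \<and> b \<le> x"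
                  using VX(2) unfolding chain_pieces_def by blast
                then have "X j = {a..b} \<and> 0 \<le> a \<and> a < b \<and> b \<le> y" using x by simp
                then show ?thesis using False by auto
              qed (use x g in auto)
              have sep: "\<exists>c. (X(i := {x..y})) j \<subseteq> {..c} \<and> (X(i := {x..y})) k \<subseteq> {c..} \<or>
                  (X(i := {x..y})) k \<subseteq> {..c} \<and> (X(i := {x..y})) j \<subseteq> {c..}"
                if jk: "j \<in> set (i # s)" "k \<in> set (i # s)" "j \<noteq> k" for j k
              proof (cases "j = i \<or> k = i")
                case True
                then show ?thesis using jk below by (intro exI[of _ x]) (auto simp: X)
              next
                case False
                then show ?thesis using VX(2) jk unfolding chain_pieces_def X by simp
              qed
              have "\<forall>j\<in>set (i # s). r j < V j ((X(i := {x..y})) j)"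
                using VX surx unfolding X chain_pieces_def by auto
              then show "chain_pieces r V (i # s) y (X(i := {x..y}))"
                unfolding chain_pieces_def using iv un' sep by blast
            qed simp
          qed (simp only: solves_empty)
        qed simp
      qed simp
    qed (simp only: solves_empty)
  qed (simp add: algebra_simps)
qed

text \<open>Greedy stays ahead: inductively, the agents served before \<open>i\<close> are finished
  by \<open>a i\<close>, so \<open>i\<close> is finished by \<open>b i\<close>.\<close>

lemma greedy_end_le_intervals:
  assumes "V \<in> P" "set s \<subseteq> {1..n}"
    and "\<And>i. i \<in> {1..n} \<Longrightarrow> 0 \<le> a i \<and> a i < b i \<and> b i \<le> 1 \<and> r i < V i {a i..b i}"
    and "sorted_wrt (\<lambda>i j. b j \<le> a i) s" "\<And>i. i \<in> set s \<Longrightarrow> b i \<le> c" "0 \<le> c"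
  shows "greedy_end r V s \<le> ereal c"
  using assms(2,4,5,6)
proof (induction s arbitrary: c)
  case (Cons i s)
  then have i: "i \<in> {1..n}" "b i \<le> c" by auto
  have "greedy_end r V s \<le> ereal (a i)"
    using Cons.prems assms(3)[OF i(1)] by (intro Cons.IH) auto
  then have "next_mark r V i (greedy_end r V s) < ereal (b i)"
    using assms(1) assms(3)[OF i(1)] i Cons.prems r P valuation_agent
    by (intro next_mark_less[where a = "a i"] greedy_end_agents) (auto intro: less_imp_le)
  then show ?case using i(2) by (auto intro: less_imp_le order_trans)
qed simp

text \<open>Greedy stays ahead when serving in the order of the pieces, and the strict surplus of
  the rightmost agent brings the end below \<open>1\<close>.\<close>

lemma greedy_end_less_intervals:
  assumes "V \<in> P" "n \<ge> 1"
    and ab: "\<And>i. i \<in> {1..n} \<Longrightarrow> 0 \<le> a i \<and> a i < b i \<and> b i \<le> 1 \<and> r i < V i {a i..b i}"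
    and disj: "\<And>i j. i \<in> {1..n} \<Longrightarrow> j \<in> {1..n} \<Longrightarrow> i \<noteq> j \<Longrightarrow> b i \<le> a j \<or> b j \<le> a i"
  obtains s where "set s = {1..n}" "distinct s" "greedy_end r V s < 1"
proof -
  \<comment> \<open>Negating the left ends puts the rightmost piece at the head, which is served
    last.\<close>
  define s where "s = sort_key (\<lambda>i. - a i) [1..<Suc n]"
  have s: "set s = {1..n}" "distinct s" by (auto simp: s_def)
  have sorted: "sorted (map (\<lambda>i. - a i) s)" by (simp add: s_def)
  have wrt: "sorted_wrt (\<lambda>i j. b j \<le> a i) s"
    unfolding sorted_wrt_iff_nth_less
  proof (intro allI impI)
    fix k l assume kl: "k < l" "l < length s"
    then have in_n: "s ! k \<in> {1..n}" "s ! l \<in> {1..n}"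
      unfolding s(1)[symmetric] by auto
    have "s ! k \<noteq> s ! l" using kl s(2) by (simp add: nth_eq_iff_index_eq)
    moreover have "a (s ! l) \<le> a (s ! k)"
      using sorted_nth_mono[OF sorted, of k l] kl by simp
    ultimately show "b (s ! l) \<le> a (s ! k)"
      using disj[OF in_n] ab[OF in_n(1)] ab[OF in_n(2)] by auto
  qed
  obtain i t where it: "s = i # t" using s(1) assms(2) by (cases s) auto
  then have i: "i \<in> {1..n}" "set t \<subseteq> {1..n}" using s(1) by auto
  have "greedy_end r V t \<le> ereal (a i)"
    using wrt i ab[OF i(1)] unfolding it
    by (intro greedy_end_le_intervals[OF assms(1) _ ab]) auto
  then have "next_mark r V i (greedy_end r V t) < ereal (b i)"
    using assms(1) ab[OF i(1)] i r P valuation_agent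
    by (intro next_mark_less[where a = "a i"] greedy_end_agents) (auto intro: less_imp_le)
  also have "\<dots> \<le> ereal 1" using ab[OF i(1)] by simp
  finally show ?thesis using that[OF s] by (simp add: it one_ereal_def)
qed

text \<open>If \<open>j\<close> is served last, switching to the table's order of
  \<open>S - {j}\<close> cannot move the end to the right, as \<open>next_mark\<close> is monotone.
  So only the choice of the last agent is left to optimize.\<close>

lemma optimal_order_step:
  assumes V: "V \<in> P" and S: "S \<subseteq> {1..n}" "S \<noteq> {}"
    and T: "\<And>i. i \<in> S \<Longrightarrow> optimal_order r V (S - {i}) (T i)"
    and u: "\<And>i. i \<in> S \<Longrightarrow> u i = next_mark r V i (snd (T i))"
  shows "optimal_order r V S (arg_min_on u S # fst (T (arg_min_on u S)), u (arg_min_on u S))"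
proof -
  let ?i = "arg_min_on u S"
  have fin: "finite S" using S finite_subset by blast
  have i: "?i \<in> S" using arg_min_if_finite(1)[OF fin S(2)] .
  have le: "u ?i \<le> u j" if "j \<in> S" for j
    using arg_min_least[OF fin S(2) that] .
  have "u ?i \<le> greedy_end r V t" if t: "set t = S" "distinct t" for t
  proof -
    obtain j t' where jt: "t = j # t'" using t(1) S(2) by (cases t) auto
    then have j: "j \<in> S" "set t' = S - {j}" "distinct t'" using t by auto
    have "u ?i \<le> u j" using le j by simp
    also have "\<dots> = next_mark r V j (snd (T j))" using u j by simp
    also have "\<dots> \<le> next_mark r V j (greedy_end r V t')"
    proof (rule next_mark_mono)
      have *: "set (fst (T j)) \<subseteq> {1..n}" "snd (T j) = greedy_end r V (fst (T j))"
        using T[OF j(1)] S by (auto simp: optimal_order_def split: prod.splits)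
      show "snd (T j) \<in> cake_points"
        using greedy_end_agents[OF V *(1)] * by simp
      show "greedy_end r V t' \<in> cake_points"
        using S j by (intro greedy_end_agents[OF V]) auto
      show "snd (T j) \<le> greedy_end r V t'"
        using T[OF j(1)] j by (auto simp: optimal_order_def split: prod.splits)
      show "valuation (V j)" "0 \<le> r j"
        using valuation_agent[OF V, of j] r[of j] j S by auto
    qed
    finally show ?thesis by (simp add: jt)
  qed
  moreover have "set (fst (T ?i)) = S - {?i}" "distinct (fst (T ?i))"
    "snd (T ?i) = greedy_end r V (fst (T ?i))"
    using T[OF i] by (auto simp: optimal_order_def split: prod.splits)
  ultimately show ?thesis using i u[OF i] by (auto simp: optimal_order_def)
qed

text \<open>One layer per cardinality: each set of that size costs one Mark query for every
  candidate for the last place, at most \<open>n\<close>.\<close>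

lemma solves_optimal_orders:
  assumes "k \<le> n"
  shows "solves n P (n * (\<Sum>j\<le>k. n choose j))
    (\<lambda>V T. \<forall>S. S \<subseteq> {1..n} \<longrightarrow> card S \<le> k \<longrightarrow> optimal_order r V S (T S))"
  using assms
proof (induction k)
  case 0
  have "optimal_order r V S ([], 0)" if "S \<subseteq> {1..n}" "card S \<le> 0" for V S
    using that finite_subset[OF that(1)] by (auto simp: optimal_order_def)
  then show ?case by (intro solves_output[where out = "\<lambda>_. ([], 0)"]) auto
next
  case (Suc k)
  let ?L = "{S. S \<subseteq> {1..n} \<and> card S = Suc k}"
  have "solves n P (n * (\<Sum>j\<le>k. n choose j))
    (\<lambda>V T. \<forall>S. S \<subseteq> {1..n} \<longrightarrow> card S \<le> k \<longrightarrow> optimal_order r V S (T S))"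
    using Suc by simp
  then show ?case
  proof (rule solves_bind)
    fix T
    let ?Q = "{V \<in> P. \<forall>S. S \<subseteq> {1..n} \<longrightarrow> card S \<le> k \<longrightarrow> optimal_order r V S (T S)}"
    have step: "solves n ?Q n (\<lambda>V. optimal_order r V S)" if S: "S \<in> ?L" for S
    proof (cases "?Q = {}")
      case False
      have opt: "optimal_order r V (S - {i}) (T (S - {i}))" if "V \<in> ?Q" "i \<in> S" for V i
        using that S by (simp add: card_Diff_singleton subset_insertI2 Diff_subset[THEN order_trans])
      have "snd (T (S - {i})) \<in> cake_points" if i: "i \<in> S" for i
      proof -
        obtain V where V: "V \<in> ?Q" using False by blast
        then have "set (fst (T (S - {i}))) \<subseteq> {1..n}"
          "snd (T (S - {i})) = greedy_end r V (fst (T (S - {i})))"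
          using opt[OF V i] S by (auto simp: optimal_order_def split: prod.splits)
        then show ?thesis using V greedy_end_agents by auto
      qed
      then have "solves n ?Q (1 * card S)
          (\<lambda>V u. \<forall>i\<in>S. u i = next_mark r V i (snd (T (S - {i}))))"
        using S by (intro solves_family solves_next_mark)
          (auto dest: finite_subset)
      then show ?thesis
      proof (rule solves_map[where f = "\<lambda>u. (arg_min_on u S #
          fst (T (S - {arg_min_on u S})), u (arg_min_on u S))"])
        fix V u assume "V \<in> ?Q" "\<forall>i\<in>S. u i = next_mark r V i (snd (T (S - {i})))"
        then show "optimal_order r V S (arg_min_on u S # fst (T (S - {arg_min_on u S})),
            u (arg_min_on u S))"
          using S opt by (intro optimal_order_step[where T = "\<lambda>i. T (S - {i})"]) auto
      next
        show "1 * card S \<le> n"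
          using S card_mono[of "{1..n}" S] by auto
      qed
    qed (simp only: solves_empty)
    have "solves n ?Q (n * card ?L) (\<lambda>V u. \<forall>S\<in>?L. optimal_order r V S (u S))"
      by (intro solves_family step) auto
    then show "solves n ?Q (n * card ?L)
        (\<lambda>V T. \<forall>S. S \<subseteq> {1..n} \<longrightarrow> card S \<le> Suc k \<longrightarrow> optimal_order r V S (T S))"
      by (rule solves_map[where f = "\<lambda>u S. if card S = Suc k then u S else T S"])
         (auto simp: le_Suc_eq)
  qed (use n_subsets[of "{1..n}" "Suc k"] in \<open>simp add: algebra_simps\<close>)
qed

end

text \<open>One algorithm serves both tasks, with \<open>None\<close> for nonexistence. An optimal
  end below \<open>1\<close> is turned into pieces; otherwise the order read off a surplus
  allocation would beat the optimum.\<close>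

lemma solves_surplus_allocation:
  assumes n: "n \<ge> 1" and r: "\<And>i. i \<in> {1..n} \<Longrightarrow> 0 < w i + z"
  shows "solves n (all_profiles n) (4 * n * 2 ^ n)
    (\<lambda>V out. case out of None \<Rightarrow> \<nexists>X. surplus_allocation n w z V X
                      | Some X \<Rightarrow> surplus_allocation n w z V X)"
proof -
  let ?r = "\<lambda>i. w i + z" and ?P = "all_profiles n"
  have "solves n ?P (n * (\<Sum>j\<le>n. n choose j))
    (\<lambda>V T. \<forall>S. S \<subseteq> {1..n} \<longrightarrow> card S \<le> n \<longrightarrow> optimal_order ?r V S (T S))"
    using r by (intro solves_optimal_orders) auto
  then show ?thesis
  proof (rule solves_bind)
    fix T :: "nat set \<Rightarrow> nat list \<times> ereal"
    obtain s e where se: "T {1..n} = (s, e)" by (cases "T {1..n}")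
    let ?Q = "{V \<in> ?P. \<forall>S. S \<subseteq> {1..n} \<longrightarrow> card S \<le> n \<longrightarrow> optimal_order ?r V S (T S)}"
    have opt: "set s = {1..n} \<and> distinct s \<and> e = greedy_end ?r V s \<and>
        (\<forall>t. set t = {1..n} \<longrightarrow> distinct t \<longrightarrow> e \<le> greedy_end ?r V t)" if "V \<in> ?Q" for V
    proof -
      have "optimal_order ?r V {1..n} (T {1..n})" using that by auto
      then show ?thesis unfolding se optimal_order_def by auto
    qed
    show "solves n ?Q (n * (n + 2)) (\<lambda>V out. case out of None \<Rightarrow> \<nexists>X. surplus_allocation n w z V X
                      | Some X \<Rightarrow> surplus_allocation n w z V X)"
    proof (cases "?Q = {}")
      case False
      then obtain V0 where "V0 \<in> ?Q" by blast
      then have s: "set s = {1..n}" "distinct s" using opt[of V0] by blast+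
      then have len: "length s = n" by (metis card_atLeastAtMost diff_Suc_1 distinct_card)
      show ?thesis
      proof (cases "e < 1")
        case True
        have "solves n ?Q (length s * (length s + 2)) (\<lambda>V X. chain_pieces ?r V s 1 X)"
          using s n r opt True
          by (intro solves_chain_pieces[where P = ?P]) (auto simp: one_ereal_def)
        then show ?thesis
          by (rule solves_map[where f = Some])
             (use s len surplus_allocation_chain_pieces in auto)
      next
        case False
        have "\<nexists>X. surplus_allocation n w z V X" if V: "V \<in> ?Q" for V
        proof
          assume "\<exists>X. surplus_allocation n w z V X"
          then obtain X where X: "surplus_allocation n w z V X" by blast
          have V': "V \<in> ?P" using V by simp
          obtain a b where ab: "\<And>i. i \<in> {1..n} \<Longrightarrow>
              X i = {a i..b i} \<and> 0 \<le> a i \<and> a i < b i \<and> b i \<le> 1 \<and> w i + z < V i {a i..b i}"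
            "\<And>i j. i \<in> {1..n} \<Longrightarrow> j \<in> {1..n} \<Longrightarrow> i \<noteq> j \<Longrightarrow> b i \<le> a j \<or> b j \<le> a i"
            using surplus_allocation_intervals[OF X V' r] by metis
          obtain t where "set t = {1..n}" "distinct t" "greedy_end ?r V t < 1"
            by (rule greedy_end_less_intervals[of n ?r ?P V a b, OF r _ V' n])
               (use ab in auto)
          then have "e < 1" using opt[OF V] le_less_trans by blast
          with False show False by simp
        qed
        then show ?thesis by (intro solves_output[where out = None]) simp
      qed
    qed (simp only: solves_empty)
  next
    \<comment> \<open>The table costs \<open>n * 2 ^ n\<close> by the binomial row sum, and the
      pieces at most three times as much.\<close>
    have "n + 2 \<le> 3 * 2 ^ n" using less_exp[of n] by linarith
    then have "n * (n + 2) \<le> n * (3 * 2 ^ n)" by (rule mult_le_mono2)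
    then show "n * (\<Sum>j\<le>n. n choose j) + n * (n + 2) \<le> 4 * n * 2 ^ n"
      by (simp add: choose_row_sum)
  qed
qed

text \<open>An algorithm that is correct on the single profile \<open>V\<close> has an output there,
  so the construction of pieces doubles as an existence proof.\<close>

lemma surplus_allocation_greedy_end:
  assumes V: "V \<in> all_profiles n" and r: "\<And>i. i \<in> {1..n} \<Longrightarrow> 0 < w i + z"
    and s: "set s = {1..n}" "distinct s" "s \<noteq> []" "greedy_end (\<lambda>i. w i + z) V s < 1"
  shows "\<exists>X. surplus_allocation n w z V X"
proof -
  have "solves n {V} (length s * (length s + 2)) (\<lambda>V X. chain_pieces (\<lambda>i. w i + z) V s 1 X)"
    using assms by (intro solves_chain_pieces[where P = "{V}"]) (auto simp: one_ereal_def)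
  then obtain X where "chain_pieces (\<lambda>i. w i + z) V s 1 X"
    by (auto simp: solves_def)
  then show ?thesis
    using surplus_allocation_chain_pieces s(1) by blast
qed

subsection \<open>Points touched by an execution\<close>

text \<open>Where distribution functions have to agree for the answers to agree. An infinite Mark
  answer contributes the harmless point \<open>0\<close>, at which they all vanish.\<close>

primrec touched :: "'o algorithm \<Rightarrow> profile \<Rightarrow> (nat \<times> real) set" where
  "touched (Output out) V = {}"
| "touched (Eval i x y k) V = {(i, x), (i, y)} \<union> touched (k (eval_answer (V i) x y)) V"
| "touched (Mark i x r k) V =
     {(i, x), (i, real_of_ereal (mark_answer (V i) x r))} \<union> touched (k (mark_answer (V i) x r)) V"

lemma finite_touched: "finite (touched A V)"
  by (induction A) auto

lemma card_insert2_le: "card (insert a (insert b B)) \<le> Suc (Suc (card B))"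
  by (cases "finite B") (auto simp: card_insert_if)

lemma card_touched: "card (touched A V) \<le> 2 * queries A V"
proof (induction A)
  case (Eval i x y k)
  then show ?case
    using card_insert2_le[of "(i, x)" "(i, y)" "touched (k (eval_answer (V i) x y)) V"]
    by (simp add: le_trans)
next
  case (Mark i x r k)
  then show ?case
    using card_insert2_le[of "(i, x)" "(i, real_of_ereal (mark_answer (V i) x r))"
        "touched (k (mark_answer (V i) x r)) V"]
    by (simp add: le_trans)
qed simp

text \<open>Agreement at the touched points makes every answer the same, so both profiles follow one
  path through the decision tree.\<close>

lemma run_eq_if_touched_eq:
  assumes "V \<in> hungry_profiles n" "V' \<in> hungry_profiles n" "legal n A V"
    and "\<And>i x. (i, x) \<in> touched A V \<Longrightarrow> V' i {0..x} = V i {0..x}"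
  shows "run A V' = run A V"
  using assms(3,4)
proof (induction A)
  case (Eval i x y k)
  then have val: "valuation (V i)" "valuation (V' i)"
    using assms(1,2) by (auto simp: hungry_profiles_def)
  have "eval_answer (V' i) x y = eval_answer (V i) x y"
    using Eval.prems valuation_Icc[OF val(1), of x y] valuation_Icc[OF val(2), of x y]
    by (simp add: eval_answer_def)
  then show ?case using Eval by simp
next
  case (Mark i x r k)
  then have val: "valuation (V i)" "valuation (V' i)" "hungry (V' i)"
    using assms(1,2) by (auto simp: hungry_profiles_def)
  have "mark_answer (V' i) x r = mark_answer (V i) x r"
    using Mark.prems val by (intro mark_answer_cong) auto
  then show ?case using Mark by simp
qed simp

subsection \<open>Greedy prefixes of hungry agents\<close>

text \<open>A hungry agent reaches a value at a single point, so a piece worth exactly the threshold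
  suffices; in general the largest such point could lie beyond \<open>b\<close>.\<close>

lemma next_mark_le_hungry:
  assumes V: "valuation (V i)" "hungry (V i)" and r: "0 \<le> r i"
    and x: "x \<in> cake_points" "x \<le> ereal a" and ab: "a \<le> b" "b \<le> 1" "r i \<le> V i {a..b}"
  shows "next_mark r V i x \<le> ereal b"
proof -
  have a: "0 \<le> a" "a \<le> 1" using x ab by (auto simp: cake_points_def)
  have "next_mark r V i x \<le> next_mark r V i (ereal a)"
    using V r x a by (intro next_mark_mono) (auto simp: cake_points_def)
  also have "\<dots> = mark_answer (V i) a (r i)" by (simp add: next_mark_def)
  also have "\<dots> \<le> ereal b"
    using V(1) a r
  proof (cases rule: mark_answer_cases)
    case infinite
    then show ?thesis
      using ab a valuation_Icc[OF V(1), of a b] valuation_mono[OF V(1), of b 1] by auto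
  next
    case (finite m)
    then show ?thesis
      using ab a valuation_Icc[OF V(1), of a b] hungry_strict_mono[OF V, of b m]
      by (cases "m \<le> b") auto
  qed
  finally show ?thesis .
qed

text \<open>A lead is never lost: a hungry agent values the extra part before \<open>a\<close>
  positively, so her piece ends before \<open>b\<close>.\<close>

lemma next_mark_less_hungry:
  assumes V: "valuation (V i)" "hungry (V i)" and r: "0 \<le> r i"
    and x: "x \<in> cake_points" "x < ereal a" and ab: "a \<le> b" "b \<le> 1" "r i \<le> V i {a..b}"
  shows "next_mark r V i x < ereal b"
proof -
  obtain u where u: "x = ereal u" "0 \<le> u" "u < a"
    using x by (auto simp: cake_points_def)
  have "V i {a..b} < V i {u..b}"
    using u ab valuation_Icc[OF V(1), of a b] valuation_Icc[OF V(1), of u b]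
      hungry_strict_mono[OF V, of u a] by simp
  then show ?thesis
    using u ab V r by (simp add: next_mark_def mark_answer_less_iff)
qed

subsection \<open>Piecewise linear distribution functions\<close>

text \<open>Density \<open>t\<close> up to \<open>b\<close> and, beyond it, the constant density
  that makes the total on \<open>[0,1]\<close> equal to \<open>1\<close>.\<close>

definition bent :: "real \<Rightarrow> real \<Rightarrow> real \<Rightarrow> real" where
  "bent t b x = t * min x b + (1 - t * b) / (1 - b) * (max x b - b)"

text \<open>A tent of half-width \<open>h\<close> around \<open>p\<close> is subtracted.\<close>

definition dented :: "real \<Rightarrow> real \<Rightarrow> real \<Rightarrow> real \<Rightarrow> real \<Rightarrow> real" where
  "dented t b p h x = bent t b x - t / 2 * max 0 (h - \<bar>x - p\<bar>)"

lemma bent_le: "x \<le> b \<Longrightarrow> bent t b x = t * x"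
  by (simp add: bent_def)

lemma dented_far: "h \<le> \<bar>x - p\<bar> \<Longrightarrow> dented t b p h x = bent t b x"
  by (simp add: dented_def)

lemma dented_le: "0 < t \<Longrightarrow> dented t b p h x \<le> bent t b x"
  by (simp add: dented_def)

context
  fixes t b :: real
  assumes t: "0 < t" "t * b < 1" and b: "0 < b" "b < 1"
begin

lemma strict_mono_bent: "strict_mono (bent t b)"
proof (rule strict_monoI)
  fix x y :: real assume xy: "x < y"
  define c where "c = (1 - t * b) / (1 - b)"
  have c: "0 < c" using t b by (simp add: c_def)
  have 1: "t * min x b \<le> t * min y b" "c * (max x b - b) \<le> c * (max y b - b)"
    using xy t c by (intro mult_left_mono; simp)+
  show "bent t b x < bent t b y"
  proof (cases "x < b")
    case True
    then have "t * min x b < t * min y b" using xy t by (intro mult_strict_left_mono) auto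
    then show ?thesis using 1 by (simp add: bent_def c_def[symmetric])
  next
    case False
    then have "c * (max x b - b) < c * (max y b - b)"
      using xy c by (intro mult_strict_left_mono) auto
    then show ?thesis using 1 by (simp add: bent_def c_def[symmetric])
  qed
qed

lemma continuous_on_bent: "continuous_on A (bent t b)"
  unfolding bent_def using b by (intro continuous_intros) auto

lemma bent_0: "bent t b 0 = 0" and bent_1: "bent t b 1 = 1"
  using b by (auto simp: bent_def)

lemma bent_diff_le:
  assumes "1 \<le> t" "x \<le> y"
  shows "bent t b y - bent t b x \<le> t * (y - x)"
proof -
  define c where "c = (1 - t * b) / (1 - b)"
  have "c \<le> t" using assms b by (simp add: c_def field_simps)
  then have "c * (max y b - max x b) \<le> t * (max y b - max x b)"
    using assms by (intro mult_right_mono) auto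
  then have "bent t b y - bent t b x \<le> t * ((min y b - min x b) + (max y b - max x b))"
    unfolding bent_def c_def[symmetric] by (simp add: algebra_simps)
  also have "(min y b - min x b) + (max y b - max x b) = y - x"
    by (simp add: min_def max_def)
  finally show ?thesis .
qed

text \<open>Up to \<open>b\<close> the tent rises at no more than half the rate of
  \<open>bent\<close>, and beyond \<open>b\<close> it has vanished.\<close>

lemma strict_mono_dented:
  assumes "p + h \<le> b"
  shows "strict_mono (dented t b p h)"
proof (rule strict_monoI)
  fix x y :: real assume xy: "x < y"
  have less: "bent t b x < bent t b y" using xy strict_mono_bent by (simp add: strict_mono_less)
  show "dented t b p h x < dented t b p h y"
  proof (cases "y \<le> b")
    case True
    have "max 0 (h - \<bar>y - p\<bar>) - max 0 (h - \<bar>x - p\<bar>) \<le> y - x" using xy by auto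
    then have "t / 2 * (max 0 (h - \<bar>y - p\<bar>) - max 0 (h - \<bar>x - p\<bar>)) \<le> t / 2 * (y - x)"
      using t by (intro mult_left_mono) auto
    also have "\<dots> < t * (y - x)" using t xy by simp
    also have "\<dots> = bent t b y - bent t b x" using True xy by (simp add: bent_le algebra_simps)
    finally show ?thesis by (simp add: dented_def algebra_simps)
  next
    case False
    have "dented t b p h x \<le> bent t b x" using dented_le t by blast
    also have "\<dots> < dented t b p h y" using less False assms by (subst dented_far) auto
    finally show ?thesis .
  qed
qed

lemma continuous_on_dented: "continuous_on A (dented t b p h)"
  unfolding dented_def by (intro continuous_intros continuous_on_bent)

lemma valuation_bent:
  shows "valuation (measure (interval_measure (bent t b)))"
    "hungry (measure (interval_measure (bent t b)))"
    "0 \<le> x \<Longrightarrow> measure (interval_measure (bent t b)) {0..x} = bent t b x"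
  using strict_mono_bent continuous_on_bent bent_0 bent_1
  by (auto intro!: valuation_interval_measure)

lemma valuation_dented:
  assumes "h \<le> p" "p + h \<le> b"
  shows "valuation (measure (interval_measure (dented t b p h)))"
    "hungry (measure (interval_measure (dented t b p h)))"
    "0 \<le> x \<Longrightarrow> measure (interval_measure (dented t b p h)) {0..x} = dented t b p h x"
proof -
  have "dented t b p h 0 = 0" "dented t b p h 1 = 1"
    using assms b bent_0 bent_1 by (simp_all add: dented_far)
  then show "valuation (measure (interval_measure (dented t b p h)))"
    "hungry (measure (interval_measure (dented t b p h)))"
    "0 \<le> x \<Longrightarrow> measure (interval_measure (dented t b p h)) {0..x} = dented t b p h x"
    using strict_mono_dented[OF assms(2)] continuous_on_dented
    by (auto intro!: valuation_interval_measure)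
qed

end

text \<open>Half-open intervals are truly disjoint, so additivity of Lebesgue measure applies inside
  \<open>{0..l}\<close>.\<close>

lemma sum_lengths_le:
  fixes c d :: "'i \<Rightarrow> real"
  assumes "finite I" "\<And>i. i \<in> I \<Longrightarrow> 0 \<le> c i \<and> c i \<le> d i \<and> d i \<le> l"
    and "\<And>i j. i \<in> I \<Longrightarrow> j \<in> I \<Longrightarrow> i \<noteq> j \<Longrightarrow> d i \<le> c j \<or> d j \<le> c i" and "0 \<le> l"
  shows "(\<Sum>i\<in>I. d i - c i) \<le> l"
proof -
  have "(\<Sum>i\<in>I. d i - c i) = (\<Sum>i\<in>I. measure lborel {c i<..d i})"
    using assms(2) by (intro sum.cong) auto
  also have "\<dots> = measure lborel (\<Union>i\<in>I. {c i<..d i})"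
  proof (rule measure_finite_Union[symmetric])
    show "disjoint_family_on (\<lambda>i. {c i<..d i}) I"
      unfolding disjoint_family_on_def using assms(3) by fastforce
  qed (use assms in auto)
  also have "\<dots> \<le> measure lborel {0..l}"
  proof (rule measure_mono_fmeasurable)
    show "(\<Union>i\<in>I. {c i<..d i}) \<subseteq> {0..l}" using assms(2) by fastforce
    show "(\<Union>i\<in>I. {c i<..d i}) \<in> sets lborel" using assms(1) by (intro sets.finite_UN) auto
  qed (use assms(4) in \<open>auto simp: fmeasurable_def\<close>)
  finally show ?thesis using assms(4) by simp
qed

subsection \<open>The hard instance\<close>

text \<open>\<open>eps_r\<close> keeps the lengths positive and separates sums over sets of
  different size. \<open>eps_z\<close> gives \<open>1 \<le> len i + bend\<close>, so none of the
  first \<open>m\<close> agents fits beyond \<open>bend\<close>. \<open>eps_mr\<close> leaves them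
  positive density there.\<close>

locale hard_instance =
  fixes m n :: nat and r z eps :: real
  assumes n_def: "n = Suc m" and r_def: "r = 1 / real n + z"
    and m: "m \<ge> 1" and z: "0 < z" and eps: "0 < eps"
    and mr: "real m * r < 1"
    and eps_r: "eps * 2 ^ n < r"
    and eps_z: "2 * (eps * 2 ^ n) \<le> real n * r - 1"
    and eps_mr: "eps * 2 ^ n < r * (1 - real m * r)"
begin

text \<open>The deficits \<open>eps * 2 ^ i\<close> encode a set of agents in binary in the total
  length \<open>pos\<close> of its pieces.\<close>

definition len :: "nat \<Rightarrow> real" where
  "len i = r - eps * 2 ^ i"

definition pos :: "nat set \<Rightarrow> real" where
  "pos S = (\<Sum>i\<in>S. len i)"

definition bend :: real where
  "bend = pos {1..m}"

definition slope :: "nat \<Rightarrow> real" where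
  "slope i = (if i = n then (1 - r) / bend else r / len i)"

definition base :: profile where
  "base i = measure (interval_measure (bent (slope i) bend))"

lemma r_pos: "0 < r" and r_less_1: "r < 1"
proof -
  show "0 < r" using z by (simp add: r_def add_pos_pos n_def)
  then have "1 * r \<le> real m * r" using m by (intro mult_right_mono) auto
  then show "r < 1" using mr by simp
qed

lemma len_bounds:
  assumes "i \<in> {1..m}"
  shows "r - eps * 2 ^ n < len i" "len i < r" "0 < len i"
proof -
  have "(2::real) ^ i < 2 ^ n" using assms by (intro power_strict_increasing) (auto simp: n_def)
  then have "eps * 2 ^ i < eps * 2 ^ n" using eps by simp
  then show "r - eps * 2 ^ n < len i" "0 < len i" using eps_r by (auto simp: len_def)
  show "len i < r" using eps by (simp add: len_def)
qed

lemma pos_insert: "finite S \<Longrightarrow> i \<notin> S \<Longrightarrow> pos (insert i S) = pos S + len i"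
  by (simp add: pos_def)

lemma pos_mono: "S \<subseteq> T \<Longrightarrow> T \<subseteq> {1..m} \<Longrightarrow> pos S \<le> pos T"
  unfolding pos_def
  by (intro sum_mono2 less_imp_le[OF len_bounds(3)]) (auto intro: finite_subset)

lemma pos_pos: "S \<subseteq> {1..m} \<Longrightarrow> S \<noteq> {} \<Longrightarrow> 0 < pos S"
  unfolding pos_def using len_bounds by (intro sum_pos) (auto intro: finite_subset)

lemma pos_nonneg: "S \<subseteq> {1..m} \<Longrightarrow> 0 \<le> pos S"
  unfolding pos_def by (intro sum_nonneg less_imp_le[OF len_bounds(3)]) auto

lemma pos_set_encode: "finite S \<Longrightarrow> pos S = real (card S) * r - eps * real (set_encode S)"
  by (simp add: pos_def len_def set_encode_def sum_subtractf sum_distrib_left)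

lemma set_encode_less: "S \<subseteq> {1..m} \<Longrightarrow> set_encode S < 2 ^ n"
proof -
  assume "S \<subseteq> {1..m}"
  then have "set_encode S \<le> (\<Sum>i=0..<n. 2 ^ i)"
    unfolding set_encode_def by (intro sum_mono2) (auto simp: n_def)
  also have "\<dots> < 2 ^ n" by (simp add: sum_power2)
  finally show ?thesis .
qed

text \<open>\<open>pos S\<close> is \<open>card S * r\<close> minus
  \<open>eps * set_encode S\<close>, a term below \<open>r\<close>. Equal sums thus have equal
  cardinalities, and then equal binary codes.\<close>

lemma inj_on_pos: "inj_on pos (Pow {1..m})"
proof (rule inj_onI)
  fix S T assume S: "S \<in> Pow {1..m}" and T: "T \<in> Pow {1..m}" and eq: "pos S = pos T"
  have fin: "finite S" "finite T" using S T by (auto intro: finite_subset)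
  have bounds: "0 \<le> eps * real (set_encode U) \<and> eps * real (set_encode U) < eps * 2 ^ n"
    if "U \<in> Pow {1..m}" for U
  proof -
    have "real (set_encode U) < 2 ^ n"
      using set_encode_less[of U] that by (metis PowD numeral_power_less_of_nat_cancel_iff of_nat_less_iff of_nat_numeral of_nat_power)
    then show ?thesis using eps by simp
  qed
  have E: "real (card S) * r - eps * real (set_encode S) = real (card T) * r - eps * real (set_encode T)"
    using eq pos_set_encode fin by simp
  have "card S = card T"
  proof (rule ccontr)
    assume "card S \<noteq> card T"
    then have "1 \<le> \<bar>real (card S) - real (card T)\<bar>" by linarith
    then have "r \<le> \<bar>real (card S) - real (card T)\<bar> * r" using r_pos by simp
    also have "\<dots> = \<bar>real (card S) * r - real (card T) * r\<bar>"
      using r_pos by (simp add: abs_mult flip: left_diff_distrib)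
    also have "\<dots> < eps * 2 ^ n" using E bounds[OF S] bounds[OF T] by linarith
    finally show False using eps_r by simp
  qed
  with E eps have "set_encode S = set_encode T" by simp
  then show "S = T" using fin by (simp add: set_encode_eq)
qed

lemma bend_le: "bend \<le> real m * r"
  unfolding bend_def pos_def using sum_mono[of "{1..m}" len "\<lambda>_. r"] len_bounds(2)
  by (auto intro: less_imp_le)

lemma bend_bounds: "0 < bend" "bend < 1" "real m * r - eps * 2 ^ n \<le> bend"
proof -
  show "0 < bend" unfolding bend_def using m by (intro pos_pos) auto
  have "eps * real (set_encode {1..m}) \<le> eps * 2 ^ n"
    using set_encode_less[of "{1..m}"] eps
    by (metis less_imp_le mult_left_mono of_nat_le_iff of_nat_numeral of_nat_power subset_refl)
  then show "real m * r - eps * 2 ^ n \<le> bend" by (simp add: bend_def pos_set_encode)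
  show "bend < 1" using bend_le mr by simp
qed

text \<open>\<open>r - len i\<close> and \<open>m * r - bend\<close> are at most
  \<open>eps * 2 ^ n\<close> each, and \<open>eps_z\<close> bounds twice that by
  \<open>n * r - 1\<close>.\<close>

lemma len_bend: "i \<in> {1..m} \<Longrightarrow> 1 \<le> len i + bend"
  using len_bounds(1)[of i] bend_bounds(3) eps_z by (simp add: n_def algebra_simps)

lemma r_bend: "1 < r + bend"
  using len_bend[of 1] len_bounds(2)[of 1] m by simp

text \<open>\<open>slope i * bend\<close> is the value of \<open>[0,bend]\<close>; being below
  \<open>1\<close>, it leaves positive density beyond, as hunger requires.\<close>

lemma slope_bounds:
  assumes "i \<in> {1..n}"
  shows "0 < slope i" "slope i * bend < 1"
proof -
  have "0 < slope i \<and> slope i * bend < 1"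
  proof (cases "i = n")
    case True
    then show ?thesis using bend_bounds r_pos r_less_1 by (simp add: slope_def)
  next
    case False
    then have i: "i \<in> {1..m}" using assms by (auto simp: n_def)
    have "r * bend \<le> r * (real m * r)" using r_pos bend_le by simp
    also have "\<dots> < r - eps * 2 ^ n" using eps_mr by (simp add: algebra_simps)
    also have "\<dots> < len i" using len_bounds(1)[OF i] .
    finally show ?thesis using False len_bounds(3)[OF i] r_pos by (simp add: slope_def field_simps)
  qed
  then show "0 < slope i" "slope i * bend < 1" by auto
qed

lemma slope_regular: "i \<in> {1..m} \<Longrightarrow> slope i = r / len i"
proof -
  assume "i \<in> {1..m}"
  then have "i \<noteq> n" unfolding n_def by simp
  then show ?thesis by (simp add: slope_def)
qed

lemma slope_len: "i \<in> {1..m} \<Longrightarrow> slope i * len i = r"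
  using len_bounds(3)[of i] by (simp add: slope_regular)

lemma
  assumes "i \<in> {1..n}"
  shows valuation_base: "valuation (base i)" "hungry (base i)"
    and base_cdf: "0 \<le> x \<Longrightarrow> base i {0..x} = bent (slope i) bend x"
  unfolding base_def using valuation_bent[OF slope_bounds[OF assms] bend_bounds(1,2)] by auto

lemma base_hungry: "base \<in> hungry_profiles n"
  using valuation_base by (simp add: hungry_profiles_def)

lemma base_Icc:
  "i \<in> {1..n} \<Longrightarrow> 0 \<le> x \<Longrightarrow> x \<le> y \<Longrightarrow> y \<le> 1 \<Longrightarrow>
     base i {x..y} = bent (slope i) bend y - bent (slope i) bend x"
  using valuation_Icc[OF valuation_base(1), of i x y] base_cdf[of i x] base_cdf[of i y] by simp

lemma equal_entitlements_plus: "equal_entitlements n i + z = r"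
  by (simp add: equal_entitlements_def r_def)

text \<open>
  Each of the first \<open>m\<close> agents needs a piece longer than \<open>len i\<close>, which leaves less than
  \<open>1 - bend\<close> for agent \<open>n\<close>. So her piece must end after \<open>bend\<close>; then it is the rightmost one, starts
  after \<open>bend\<close>, and is worth less than \<open>r\<close>.
\<close>

lemma no_surplus_base: "\<not> surplus_allocation n (equal_entitlements n) z base X"
proof
  assume X: "surplus_allocation n (equal_entitlements n) z base X"
  have all: "base \<in> all_profiles n" using base_hungry by (auto simp: hungry_profiles_def all_profiles_def)
  have rp: "0 < equal_entitlements n i + z" for i using r_pos equal_entitlements_plus by simp
  obtain c d where cd: "\<And>i. i \<in> {1..n} \<Longrightarrow>
      0 \<le> c i \<and> c i < d i \<and> d i \<le> 1 \<and> r < base i {c i..d i}"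
    and disj: "\<And>i j. i \<in> {1..n} \<Longrightarrow> j \<in> {1..n} \<Longrightarrow> i \<noteq> j \<Longrightarrow> d i \<le> c j \<or> d j \<le> c i"
    using surplus_allocation_intervals[OF X all rp] unfolding equal_entitlements_plus by metis
  have sub: "{1..m} \<subseteq> {1..n}" and n: "n \<in> {1..n}" by (auto simp: n_def)
  have long: "len i < d i - c i" if i: "i \<in> {1..m}" for i
  proof -
    have i': "i \<in> {1..n}" using i sub by blast
    \<comment> \<open>With slope at least \<open>1\<close>, the slope bounds the density everywhere,
      not only left of \<open>bend\<close>.\<close>
    have "1 \<le> slope i" using slope_regular[OF i] len_bounds[OF i] by simp
    then have "base i {c i..d i} \<le> slope i * (d i - c i)"
      using cd[OF i'] bent_diff_le[OF slope_bounds[OF i'] bend_bounds(1,2)]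
      by (subst base_Icc) (use i' in auto)
    then have "r < slope i * (d i - c i)" using cd[OF i'] by linarith
    then have "slope i * len i < slope i * (d i - c i)" using slope_len[OF i] by simp
    then show ?thesis using slope_bounds(1)[OF i'] by simp
  qed
  have total: "bend < (\<Sum>i\<in>{1..m}. d i - c i)"
    unfolding bend_def pos_def using long m by (intro sum_strict_mono) auto
  have "(\<Sum>i\<in>{1..n}. d i - c i) \<le> 1"
  proof (rule sum_lengths_le)
    show "0 \<le> c i \<and> c i \<le> d i \<and> d i \<le> 1" if "i \<in> {1..n}" for i
      using cd[OF that] by simp
  qed (use disj in auto)
  then have short: "d n - c n < 1 - bend"
    using total by (simp add: n_def)
  have "bend < d n"
  proof (rule ccontr)
    assume "\<not> bend < d n"
    then have le: "d n \<le> bend" "c n \<le> bend" using cd[OF n] by auto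
    have "base n {c n..d n} = bent (slope n) bend (d n) - bent (slope n) bend (c n)"
      using cd[OF n] n by (intro base_Icc) auto
    also have "\<dots> = slope n * (d n - c n)"
      using le by (simp add: bent_le algebra_simps)
    also have "\<dots> \<le> slope n * (1 - bend)"
      using slope_bounds(1)[OF n] short by (intro mult_left_mono) auto
    \<comment> \<open>Multiplying by \<open>bend\<close> and expanding turns this into
      \<open>1 \<le> r + bend\<close>.\<close>
    also have "\<dots> \<le> r"
      using r_bend bend_bounds by (simp add: slope_def field_simps)
    finally show False using cd[OF n] by simp
  qed
  \<comment> \<open>A piece to the right of agent \<open>n\<close> would start beyond
    \<open>bend\<close> and, being longer than \<open>len i\<close>, end beyond
    \<open>1\<close>.\<close>
  then have left: "d i \<le> c n" if i: "i \<in> {1..m}" for i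
  proof -
    have i': "i \<in> {1..n}" "i \<noteq> n" using i by (auto simp: n_def)
    show ?thesis
      using disj[OF i'(1) n i'(2)] long[OF i] len_bend[OF i] cd[OF i'(1)] \<open>bend < d n\<close> by linarith
  qed
  \<comment> \<open>All these pieces lie left of \<open>c n\<close>, which pushes \<open>c n\<close>
    beyond \<open>bend\<close>, where less than \<open>r\<close> is left for agent
    \<open>n\<close>.\<close>
  have "(\<Sum>i\<in>{1..m}. d i - c i) \<le> c n"
  proof (rule sum_lengths_le)
    show "0 \<le> c i \<and> c i \<le> d i \<and> d i \<le> c n" if "i \<in> {1..m}" for i
      using that cd[of i] left[of i] sub by auto
  qed (use disj sub cd[OF n] in auto)
  then have "bend < c n" using total by simp
  then have "bent (slope n) bend bend < bent (slope n) bend (c n)"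
    using strict_mono_bent[OF slope_bounds[OF n] bend_bounds(1,2)] by (simp add: strict_mono_less)
  moreover have "bent (slope n) bend bend = 1 - r"
    using bend_bounds by (simp add: bent_le slope_def)
  moreover have "bent (slope n) bend (d n) \<le> bent (slope n) bend 1"
    using strict_mono_bent[OF slope_bounds[OF n] bend_bounds(1,2)] cd[OF n]
    by (simp add: strict_mono_less_eq)
  ultimately show False
    using cd[OF n] base_Icc[OF n, of "c n" "d n"] bent_1[OF slope_bounds[OF n] bend_bounds(1,2)]
    by simp
qed

section \<open>Perturbed profiles and their surplus allocations\<close>

definition perturbed :: "nat \<Rightarrow> real \<Rightarrow> real \<Rightarrow> profile" where
  "perturbed i p h = base(i := measure (interval_measure (dented (slope i) bend p h)))"

context
  fixes i :: nat and S :: "nat set" and h :: real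
  assumes i: "i \<in> {1..m}" and S: "S \<subseteq> {1..m} - {i}" "S \<noteq> {}"
    and h: "0 < h" "h \<le> pos S" "h \<le> len i"
begin

private lemma i_n: "i \<in> {1..n}"
  using i by (simp add: n_def)

text \<open>\<open>insert i S\<close> still consists of agents up to \<open>m\<close>. So a dent
  around \<open>pos S\<close> of half-width at most \<open>len i\<close> ends before
  \<open>bend\<close>.\<close>

private lemma pos_bend: "pos S + len i \<le> bend" and finite_S: "finite S"
proof -
  show "finite S" using S by (auto intro: finite_subset)
  then have "pos S + len i = pos (insert i S)" using S by (subst pos_insert) auto
  also have "\<dots> \<le> bend" unfolding bend_def using S i by (intro pos_mono) auto
  finally show "pos S + len i \<le> bend" .
qed

lemma
  shows valuation_perturbed: "valuation (perturbed i (pos S) h i)" "hungry (perturbed i (pos S) h i)"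
    and perturbed_cdf: "0 \<le> x \<Longrightarrow> perturbed i (pos S) h i {0..x} = dented (slope i) bend (pos S) h x"
proof -
  have "pos S + h \<le> bend" using pos_bend h by linarith
  note * = valuation_dented[OF slope_bounds[OF i_n] bend_bounds(1,2) h(2) this]
  show "valuation (perturbed i (pos S) h i)" "hungry (perturbed i (pos S) h i)"
    "0 \<le> x \<Longrightarrow> perturbed i (pos S) h i {0..x} = dented (slope i) bend (pos S) h x"
    using * by (simp_all add: perturbed_def)
qed

lemma perturbed_hungry: "perturbed i (pos S) h \<in> hungry_profiles n"
  using valuation_perturbed valuation_base by (auto simp: hungry_profiles_def perturbed_def)

private lemma perturbed_points: "set s \<subseteq> {1..n} \<Longrightarrow>
    greedy_end (\<lambda>_. r) (perturbed i (pos S) h) s \<in> cake_points"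
  using perturbed_hungry r_pos
  by (intro greedy_end_cake_points) (auto simp: hungry_profiles_def less_imp_le)

text \<open>An unperturbed agent has constant density left of \<open>bend\<close>, so there every
  interval of length \<open>len j\<close> is worth exactly \<open>r\<close>.\<close>

lemma perturbed_piece:
  assumes "j \<in> {1..m}" "j \<noteq> i" "T \<subseteq> {1..m} - {j}"
  shows "perturbed i (pos S) h j {pos T..pos (insert j T)} = r" "pos T \<le> pos (insert j T)"
    "pos (insert j T) \<le> 1"
proof -
  have fin: "finite T" using assms by (auto intro: finite_subset)
  have ins: "pos (insert j T) = pos T + len j" using assms fin by (intro pos_insert) auto
  have le: "pos (insert j T) \<le> bend" unfolding bend_def using assms by (intro pos_mono) auto
  have len: "0 < len j" using len_bounds assms by blast
  have T: "0 \<le> pos T" using assms by (intro pos_nonneg) auto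
  show le': "pos T \<le> pos (insert j T)" "pos (insert j T) \<le> 1"
    using ins len le bend_bounds by auto
  have "perturbed i (pos S) h j {pos T..pos (insert j T)} = base j {pos T..pos (insert j T)}"
    using assms by (simp add: perturbed_def)
  also have "\<dots> = slope j * pos (insert j T) - slope j * pos T"
    using assms T le le' ins len by (subst base_Icc) (auto simp: n_def bent_le)
  also have "\<dots> = r" using slope_len[OF assms(1)] by (simp add: ins algebra_simps)
  finally show "perturbed i (pos S) h j {pos T..pos (insert j T)} = r" .
qed

lemma greedy_end_perturbed_before:
  assumes "distinct s" "set s \<subseteq> {1..m} - {i}"
  shows "greedy_end (\<lambda>_. r) (perturbed i (pos S) h) s \<le> ereal (pos (set s))"
  using assms
proof (induction s)
  case Nil
  then show ?case by (simp add: pos_def)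
next
  case (Cons j s)
  then have j: "j \<in> {1..m}" "j \<noteq> i" "set s \<subseteq> {1..m} - {j}" by auto
  have hun: "valuation (perturbed i (pos S) h j)" "hungry (perturbed i (pos S) h j)"
    using perturbed_hungry j by (auto simp: hungry_profiles_def n_def)
  have pts: "greedy_end (\<lambda>_. r) (perturbed i (pos S) h) s \<in> cake_points"
    using Cons.prems by (intro perturbed_points) (auto simp: n_def)
  have "greedy_end (\<lambda>_. r) (perturbed i (pos S) h) s \<le> ereal (pos (set s))"
    using Cons by simp
  then show ?case
    unfolding greedy_end.simps list.set using hun pts perturbed_piece[OF j] r_pos
    by (intro next_mark_le_hungry[where a = "pos (set s)"]) auto
qed

text \<open>The dent lowers the distribution function by \<open>slope i / 2 * h\<close> at
  \<open>pos S\<close> and has vanished at \<open>pos S + len i\<close>, so agent \<open>i\<close>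
  gains that amount.\<close>

lemma perturbed_gap: "r < perturbed i (pos S) h i {pos S..pos (insert i S)}"
proof -
  have p: "pos (insert i S) = pos S + len i" using S finite_S by (intro pos_insert) auto
  have "0 < pos S" using S by (intro pos_pos) auto
  have "perturbed i (pos S) h i {pos S..pos (insert i S)} =
      dented (slope i) bend (pos S) h (pos S + len i) - dented (slope i) bend (pos S) h (pos S)"
    using valuation_Icc[OF valuation_perturbed(1), of "pos S" "pos (insert i S)"]
      perturbed_cdf[of "pos S"] perturbed_cdf[of "pos S + len i"] p \<open>0 < pos S\<close>
      len_bounds(3)[OF i] pos_bend bend_bounds by simp
  also have "\<dots> = slope i * (pos S + len i) - (slope i * pos S - slope i / 2 * h)"
  proof -
    have "dented (slope i) bend (pos S) h (pos S + len i) = slope i * (pos S + len i)"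
      using h pos_bend by (subst dented_far) (auto simp: bent_le)
    moreover have "dented (slope i) bend (pos S) h (pos S) = slope i * pos S - slope i / 2 * h"
      using h pos_bend len_bounds(3)[OF i] by (simp add: dented_def bent_le)
    ultimately show ?thesis by simp
  qed
  also have "\<dots> = r + slope i / 2 * h" using slope_len[OF i] by (simp add: algebra_simps)
  finally show ?thesis using slope_bounds(1)[OF i_n] h(1) by simp
qed

text \<open>The gain lets agent \<open>i\<close> finish early, and the hungry agents after her pass
  the lead on.\<close>

lemma greedy_end_perturbed_after:
  assumes "distinct s" "set s = S" "distinct t" "set t \<subseteq> {1..m} - insert i S"
  shows "greedy_end (\<lambda>_. r) (perturbed i (pos S) h) (t @ i # s) < ereal (pos (set t \<union> insert i S))"
  using assms(3,4)
proof (induction t)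
  case Nil
  have "pos (insert i S) = pos S + len i" using S finite_S by (intro pos_insert) auto
  moreover have "greedy_end (\<lambda>_. r) (perturbed i (pos S) h) s \<le> ereal (pos S)"
    using greedy_end_perturbed_before[of s] assms S by auto
  moreover have "greedy_end (\<lambda>_. r) (perturbed i (pos S) h) s \<in> cake_points"
    using assms S by (intro perturbed_points) (auto simp: n_def)
  ultimately show ?case
    using valuation_perturbed perturbed_gap r_pos len_bounds(3)[OF i] pos_bend bend_bounds
    by (auto intro!: next_mark_less[where a = "pos S"])
next
  case (Cons j t)
  let ?T = "set t \<union> insert i S"
  have j: "j \<in> {1..m}" "j \<noteq> i" "?T \<subseteq> {1..m} - {j}" using Cons.prems S i by auto
  have hun: "valuation (perturbed i (pos S) h j)" "hungry (perturbed i (pos S) h j)"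
    using perturbed_hungry j by (auto simp: hungry_profiles_def n_def)
  have IH: "greedy_end (\<lambda>_. r) (perturbed i (pos S) h) (t @ i # s) < ereal (pos ?T)"
    using Cons by simp
  have pts: "greedy_end (\<lambda>_. r) (perturbed i (pos S) h) (t @ i # s) \<in> cake_points"
    using assms S Cons.prems i by (intro perturbed_points) (auto simp: n_def)
  have "next_mark (\<lambda>_. r) (perturbed i (pos S) h) j
      (greedy_end (\<lambda>_. r) (perturbed i (pos S) h) (t @ i # s)) < ereal (pos (insert j ?T))"
    using hun IH pts perturbed_piece[OF j] r_pos
    by (intro next_mark_less_hungry[where a = "pos ?T"]) auto
  then show ?case by (simp add: insert_commute)
qed

text \<open>The order is \<open>S\<close>, then \<open>i\<close>, then the rest, and agent
  \<open>n\<close> last: she starts before \<open>bend\<close> and so finishes before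
  \<open>1\<close>.\<close>

lemma surplus_perturbed:
  "\<exists>X. surplus_allocation n (equal_entitlements n) z (perturbed i (pos S) h) X"
proof -
  obtain s where s: "set s = S" "distinct s" using finite_distinct_list[OF finite_S] by blast
  obtain t where t: "set t = {1..m} - insert i S" "distinct t"
    using finite_distinct_list[of "{1..m} - insert i S"] by auto
  have n: "n \<in> {1..n}" "n \<noteq> i" using i by (auto simp: n_def)
  have hun: "valuation (perturbed i (pos S) h n)" "hungry (perturbed i (pos S) h n)"
    using perturbed_hungry n by (auto simp: hungry_profiles_def)
  have "set t \<union> insert i S = {1..m}" using t S i by auto
  then have lt: "greedy_end (\<lambda>_. r) (perturbed i (pos S) h) (t @ i # s) < ereal bend"
    using greedy_end_perturbed_after[of s t] s t by (simp add: bend_def)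
  have pts: "greedy_end (\<lambda>_. r) (perturbed i (pos S) h) (t @ i # s) \<in> cake_points"
    using s t S i by (intro perturbed_points) (auto simp: n_def)
  have "perturbed i (pos S) h n {bend..1} = base n {bend..1}" using n by (simp add: perturbed_def)
  also have "\<dots> = r"
    using base_Icc[OF n(1), of bend 1] bend_bounds bent_1[OF slope_bounds[OF n(1)] bend_bounds(1,2)]
    by (simp add: bent_le slope_def)
  finally have "next_mark (\<lambda>_. r) (perturbed i (pos S) h) n
      (greedy_end (\<lambda>_. r) (perturbed i (pos S) h) (t @ i # s)) < ereal 1"
    using hun lt pts r_pos bend_bounds by (intro next_mark_less_hungry[where a = bend]) auto
  then have "greedy_end (\<lambda>i. equal_entitlements n i + z) (perturbed i (pos S) h) (n # t @ i # s) < 1"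
    by (simp add: equal_entitlements_plus one_ereal_def)
  moreover have "set (n # t @ i # s) = {1..n}" "distinct (n # t @ i # s)"
    using s t S i by (auto simp: n_def)
  moreover have "perturbed i (pos S) h \<in> all_profiles n"
    using perturbed_hungry by (auto simp: hungry_profiles_def all_profiles_def)
  moreover have "0 < equal_entitlements n i + z" for i
    using r_pos equal_entitlements_plus by simp
  ultimately show ?thesis by (intro surplus_allocation_greedy_end[where s = "n # t @ i # s"]) auto
qed

end

end

section \<open>Counting the points that a correct algorithm touches\<close>

context hard_instance
begin

text \<open>The possible places of dents. The empty set is left out because
  \<open>pos {} = 0\<close> leaves no room for a dent.\<close>

definition critical :: "(nat \<times> real) set" where
  "critical = (\<lambda>(i, S). (i, pos S)) ` (SIGMA i:{1..m}. Pow ({1..m} - {i}) - {{}})"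

lemma finite_critical: "finite critical"
  unfolding critical_def by (intro finite_imageI finite_SigmaI) auto

lemma card_critical: "card critical = m * (2 ^ (m - 1) - 1)"
proof -
  have "inj_on (\<lambda>(i, S). (i, pos S)) (SIGMA i:{1..m}. Pow ({1..m} - {i}) - {{}})"
  proof (rule inj_onI)
    fix x y
    assume x: "x \<in> (SIGMA i:{1..m}. Pow ({1..m} - {i}) - {{}})"
      and y: "y \<in> (SIGMA i:{1..m}. Pow ({1..m} - {i}) - {{}})"
      and eq: "(\<lambda>(i, S). (i, pos S)) x = (\<lambda>(i, S). (i, pos S)) y"
    have "snd x = snd y"
      using x y eq by (intro inj_onD[OF inj_on_pos]) auto
    then show "x = y" using eq by (auto simp: case_prod_beta prod_eq_iff)
  qed
  then have "card critical = card (SIGMA i:{1..m}. Pow ({1..m} - {i}) - {{}})"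
    unfolding critical_def by (rule card_image)
  also have "\<dots> = (\<Sum>i\<in>{1..m}. card (Pow ({1..m} - {i}) - {{}}))"
    by (rule card_SigmaI) auto
  also have "\<dots> = (\<Sum>i\<in>{1..m}. 2 ^ (m - 1) - 1)"
    by (rule sum.cong) (auto simp: card_Diff_singleton card_Pow)
  finally show ?thesis by simp
qed

text \<open>A narrow dent avoids all touched points and goes unnoticed. It only lowers the
  distribution function, so an interval can gain value only if its left end lies in the
  dent.\<close>

lemma untouched_perturbation:
  assumes "(i, p) \<in> critical - touched A base" "legal n A base" "0 < (e :: real)"
  obtains V where "V \<in> hungry_profiles n" "run A V = run A base"
    "\<exists>X. surplus_allocation n (equal_entitlements n) z V X"
    "\<And>j. j \<noteq> i \<Longrightarrow> V j = base j"
    "\<And>c d. 0 \<le> c \<Longrightarrow> c \<le> d \<Longrightarrow> d \<le> 1 \<Longrightarrow> base i {c..d} < V i {c..d} \<Longrightarrow> \<bar>c - p\<bar> < e"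
proof -
  from assms(1) obtain x where x: "x \<in> (SIGMA i:{1..m}. Pow ({1..m} - {i}) - {{}})"
      "(i, p) = (\<lambda>(i, S). (i, pos S)) x"
    unfolding critical_def by blast
  obtain S where "x = (i, S)" using x(2) by (cases x) auto
  with x have i: "i \<in> {1..m}" and S: "S \<subseteq> {1..m} - {i}" "S \<noteq> {}" and p: "p = pos S"
    by simp_all
  have i_n: "i \<in> {1..n}" using i by (simp add: n_def)
  \<comment> \<open>Bounds on the half-width: \<open>p\<close> and \<open>len i\<close> keep the
    dent admissible, \<open>e\<close> localizes it, and the distances keep it off the touched
    points.\<close>
  define H where "H = {p, len i, e} \<union> (\<lambda>(j, x). \<bar>x - p\<bar>) ` (touched A base \<inter> {i} \<times> UNIV)"
  define h where "h = Min H"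
  have "finite H" by (simp add: H_def finite_touched)
  then have le: "h \<le> y" if "y \<in> H" for y using that by (simp add: h_def)
  have "0 < p" unfolding p using S by (intro pos_pos) auto
  moreover have "0 < \<bar>x - p\<bar>" if "(i, x) \<in> touched A base" for x using that assms(1) by auto
  ultimately have "0 < y" if "y \<in> H" for y
    using that assms(3) len_bounds(3)[OF i] by (auto simp: H_def)
  then have h: "0 < h" using Min_in[OF \<open>finite H\<close>] by (auto simp: h_def H_def)
  have h': "h \<le> pos S" "h \<le> len i" "h \<le> e" using le[of p] le[of "len i"] le[of e] by (auto simp: H_def p)
  let ?V = "perturbed i (pos S) h"
  note V = valuation_perturbed[OF i S h h'(1,2)] perturbed_cdf[OF i S h h'(1,2)]
  \<comment> \<open>For negative \<open>x\<close> the interval is empty and both values are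
    zero.\<close>
  have cdf: "?V i {0..x} = base i {0..x}" if "h \<le> \<bar>x - p\<bar>" for x
    using that V(3)[of x] base_cdf[OF i_n, of x] valuation_empty[OF V(1)]
      valuation_empty[OF valuation_base(1)[OF i_n]] dented_far
    by (cases "0 \<le> x") (auto simp: p)
  show ?thesis
  proof
    show hun: "?V \<in> hungry_profiles n" using perturbed_hungry[OF i S h h'(1,2)] .
    show "\<exists>X. surplus_allocation n (equal_entitlements n) z ?V X"
      using surplus_perturbed[OF i S h h'(1,2)] .
    show other: "?V j = base j" if "j \<noteq> i" for j using that by (simp add: perturbed_def)
    show "run A ?V = run A base"
    proof (rule run_eq_if_touched_eq[OF base_hungry hun assms(2)])
      fix j x assume jx: "(j, x) \<in> touched A base"
      show "?V j {0..x} = base j {0..x}"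
      proof (cases "j = i")
        case True
        with jx have "\<bar>x - p\<bar> \<in> H" by (force simp: H_def)
        then show ?thesis using cdf le True by blast
      qed (simp add: other)
    qed
    fix c d assume cd: "0 \<le> c" "c \<le> d" "d \<le> 1" "base i {c..d} < ?V i {c..d}"
    have "?V i {0..d} \<le> base i {0..d}"
      using V(3)[of d] base_cdf[OF i_n, of d] cd dented_le[OF slope_bounds(1)[OF i_n]] by simp
    then have "?V i {0..c} \<noteq> base i {0..c}"
      using cd valuation_Icc[OF V(1), of c d] valuation_Icc[OF valuation_base(1)[OF i_n], of c d]
      by linarith
    then show "\<bar>c - p\<bar> < e" using cdf[of c] h'(3) by linarith
  qed
qed

text \<open>
  A surplus allocation of a perturbed profile that is none of the base profile must have its cut
  left of the perturbed agent inside the dent, so it determines the perturbation.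
\<close>

lemma untouched_unique:
  fixes R :: "profile \<Rightarrow> 'o \<Rightarrow> bool"
  assumes A: "\<And>V. V \<in> hungry_profiles n \<Longrightarrow> legal n A V \<and> R V (run A V)"
    and R: "\<And>V V' V'' out. R V out \<Longrightarrow> R V' out \<Longrightarrow> R V'' out \<Longrightarrow>
      \<nexists>X. surplus_allocation n (equal_entitlements n) z V X \<Longrightarrow>
      \<exists>X. surplus_allocation n (equal_entitlements n) z V' X \<Longrightarrow>
      \<exists>X. surplus_allocation n (equal_entitlements n) z V'' X \<Longrightarrow>
      \<exists>X. surplus_allocation n (equal_entitlements n) z V' X \<and>
          surplus_allocation n (equal_entitlements n) z V'' X"
    and x: "(i, p) \<in> critical - touched A base" and y: "(j, q) \<in> critical - touched A base"
  shows "(i, p) = (j, q)"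
proof (rule ccontr)
  let ?sur = "surplus_allocation n (equal_entitlements n) z"
  assume neq: "(i, p) \<noteq> (j, q)"
  \<comment> \<open>Dents at different points become too narrow to contain a common cut. If
    \<open>p = q\<close>, the agents differ and any width will do.\<close>
  define e where "e = (if p = q then 1 else \<bar>p - q\<bar> / 2)"
  have e: "0 < e" by (simp add: e_def)
  have legal: "legal n A base" using A base_hungry by blast
  obtain V where V: "V \<in> hungry_profiles n" "run A V = run A base" "\<exists>X. ?sur V X"
    "\<And>k. k \<noteq> i \<Longrightarrow> V k = base k"
    "\<And>c d. 0 \<le> c \<Longrightarrow> c \<le> d \<Longrightarrow> d \<le> 1 \<Longrightarrow> base i {c..d} < V i {c..d} \<Longrightarrow> \<bar>c - p\<bar> < e"
    using untouched_perturbation[OF x legal e] by blast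
  obtain W where W: "W \<in> hungry_profiles n" "run A W = run A base" "\<exists>X. ?sur W X"
    "\<And>k. k \<noteq> j \<Longrightarrow> W k = base k"
    "\<And>c d. 0 \<le> c \<Longrightarrow> c \<le> d \<Longrightarrow> d \<le> 1 \<Longrightarrow> base j {c..d} < W j {c..d} \<Longrightarrow> \<bar>c - q\<bar> < e"
    using untouched_perturbation[OF y legal e] by blast
  have "\<exists>X. ?sur V X \<and> ?sur W X"
  proof (rule R[where V = base])
    show "R base (run A base)" using A base_hungry by blast
    show "R V (run A base)" using A[OF V(1)] V(2) by simp
    show "R W (run A base)" using A[OF W(1)] W(2) by simp
  qed (use no_surplus_base V(3) W(3) in auto)
  then obtain X where X: "?sur V X" "?sur W X" by blast
  \<comment> \<open>Agent \<open>k\<close> falls short in \<open>X\<close> under the base profile,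
    so both perturbations must have changed her valuation.\<close>
  obtain k where k: "k \<in> {1..n}" "base k (X k) \<le> r"
    using no_surplus_base[of X] X(1) equal_entitlements_plus
    unfolding surplus_allocation_def by force
  have "r < V k (X k)" "r < W k (X k)"
    using X k equal_entitlements_plus[of k] unfolding surplus_allocation_def by auto
  with k V(4)[of k] W(4)[of k] have kij: "k = i" "k = j" by force+
  have all: "V \<in> all_profiles n" using V(1) by (auto simp: hungry_profiles_def all_profiles_def)
  have rp: "0 < equal_entitlements n l + z" for l using r_pos equal_entitlements_plus by simp
  obtain c d where cd: "X k = {c..d}" "0 \<le> c" "c < d" "d \<le> 1"
    using surplus_allocation_intervals[OF X(1) all rp] k(1) by metis
  have "\<bar>c - p\<bar> < e" "\<bar>c - q\<bar> < e"
    using V(5)[of c d] W(5)[of c d] cd kij k \<open>r < V k (X k)\<close> \<open>r < W k (X k)\<close> by auto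
  moreover have "p \<noteq> q" using neq kij by auto
  ultimately show False by (simp add: e_def abs_if split: if_splits)
qed

text \<open>At most one critical point is untouched, and a query touches at most two. The condition
  on \<open>R\<close> fits both tasks: no decision is right both with and without a surplus
  allocation, and a computed output right for two profiles that have one is a common one.\<close>

lemma queries_base_ge:
  assumes A: "\<And>V. V \<in> hungry_profiles n \<Longrightarrow> legal n A V \<and> R V (run A V)"
    and R: "\<And>V V' V'' out. R V out \<Longrightarrow> R V' out \<Longrightarrow> R V'' out \<Longrightarrow>
      \<nexists>X. surplus_allocation n (equal_entitlements n) z V X \<Longrightarrow>
      \<exists>X. surplus_allocation n (equal_entitlements n) z V' X \<Longrightarrow>
      \<exists>X. surplus_allocation n (equal_entitlements n) z V'' X \<Longrightarrow>
      \<exists>X. surplus_allocation n (equal_entitlements n) z V' X \<and>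
          surplus_allocation n (equal_entitlements n) z V'' X"
  shows "m * (2 ^ (m - 1) - 1) \<le> 2 * queries A base + 1"
proof -
  have "card (critical - touched A base) \<le> 1"
  proof -
    have "x = y" if "x \<in> critical - touched A base" "y \<in> critical - touched A base" for x y
      using untouched_unique[where A = A and R = R and i = "fst x" and p = "snd x" and j = "fst y"
          and q = "snd y", OF A R] that
      by simp
    then show ?thesis by (simp add: card_le_Suc0_iff_eq finite_critical)
  qed
  moreover have "card critical \<le> card (touched A base) + card (critical - touched A base)"
    using card_Un_le[of "touched A base" "critical - touched A base"]
      card_mono[of "touched A base \<union> (critical - touched A base)" critical]
    by (simp add: finite_touched finite_critical)
  ultimately show ?thesis
    using card_touched[of A base] card_critical by linarith
qed

end

subsection \<open>Query complexity\<close>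

text \<open>With \<open>m = k + 3\<close> and \<open>K = 2 ^ k\<close> everything is linear in
  \<open>k\<close>, \<open>K\<close> and \<open>k * K\<close>, and \<open>k \<le> k * K\<close>
  absorbs the subtracted terms.\<close>

lemma hard_instance_arith:
  fixes m q :: nat
  assumes "3 \<le> m" "m * (2 ^ (m - 1) - 1) \<le> 2 * q + 1"
  shows "Suc m * 2 ^ Suc m \<le> 32 * q"
proof -
  define k where "k = m - 3"
  define K :: nat where "K = 2 ^ k"
  have k: "m = k + 3" using assms(1) by (simp add: k_def)
  have K: "1 \<le> K" by (simp add: K_def)
  have "(k + 3) * (4 * K - 1) \<le> 2 * q + 1"
    using assms(2) by (simp add: k K_def power_add)
  moreover have "Suc m * 2 ^ Suc m = 16 * (k * K) + 64 * K"
    by (simp add: k K_def power_add algebra_simps)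
  moreover have "(k + 3) * (4 * K - 1) + k + 3 = 4 * (k * K) + 12 * K"
    using K by (cases K) (auto simp: algebra_simps)
  moreover have "k \<le> k * K" using K by simp
  ultimately show ?thesis using K by linarith
qed

lemma query_complexity_lower_bound:
  fixes R :: "profile \<Rightarrow> 'o \<Rightarrow> bool"
  assumes n: "n \<ge> 4" and z: "0 < z" "z < 1 / (real n * (real n - 1))"
    and R: "\<And>V V' V'' out. R V out \<Longrightarrow> R V' out \<Longrightarrow> R V'' out \<Longrightarrow>
      \<nexists>X. surplus_allocation n (equal_entitlements n) z V X \<Longrightarrow>
      \<exists>X. surplus_allocation n (equal_entitlements n) z V' X \<Longrightarrow>
      \<exists>X. surplus_allocation n (equal_entitlements n) z V'' X \<Longrightarrow>
      \<exists>X. surplus_allocation n (equal_entitlements n) z V' X \<and>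
          surplus_allocation n (equal_entitlements n) z V'' X"
  shows "enat ((n * 2 ^ n + 31) div 32) \<le> query_complexity n (hungry_profiles n) R"
proof -
  define m where "m = n - 1"
  have nm: "n = Suc m" and m3: "m \<ge> 3" using n by (auto simp: m_def)
  define r where "r = 1 / real n + z"
  \<comment> \<open>The least of the bounds in the hard instance. There \<open>eps * 2 ^ n\<close>
    becomes \<open>a / 2\<close>, strictly below the first and third, and twice it is at most the
    second.\<close>
  define a where "a = min (min r (real n * r - 1)) (r * (1 - real m * r))"
  have r: "0 < r" using z by (simp add: r_def nm add_pos_pos)
  have nr: "real n * r - 1 = real n * z" using n by (simp add: r_def field_simps)
  \<comment> \<open>The upper bound on \<open>z\<close> enters here: \<open>m * z < 1 / n\<close>,
    while \<open>m / n = 1 - 1 / n\<close>.\<close>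
  have mr: "real m * r < 1"
  proof -
    have "real m * z < real m * (1 / (real n * (real n - 1)))"
      using z m3 by (intro mult_strict_left_mono) auto
    also have "\<dots> = 1 / real n" using m3 by (simp add: nm)
    finally show ?thesis using m3 by (simp add: r_def nm field_simps)
  qed
  have a: "0 < a" using r nr mr z n by (simp add: a_def)
  interpret hard_instance m n r z "a / 2 ^ Suc n"
  proof unfold_locales
    show "n = Suc m" "r = 1 / real n + z" using nm r_def by auto
    have half: "a / 2 ^ Suc n * 2 ^ n = a / 2" by simp
    show "1 \<le> m" "0 < z" "0 < a / 2 ^ Suc n" "real m * r < 1" using m3 z a mr by auto
    show "a / 2 ^ Suc n * 2 ^ n < r" "2 * (a / 2 ^ Suc n * 2 ^ n) \<le> real n * r - 1"
      "a / 2 ^ Suc n * 2 ^ n < r * (1 - real m * r)"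
      unfolding half using a by (auto simp: a_def)
  qed
  show ?thesis
  proof (rule query_complexity_ge[OF base_hungry])
    fix A assume A: "\<And>V. V \<in> hungry_profiles n \<Longrightarrow> legal n A V \<and> R V (run A V)"
    have "m * (2 ^ (m - 1) - 1) \<le> 2 * queries A base + 1"
      by (rule queries_base_ge[where R = R, OF A R])
    from hard_instance_arith[OF m3 this] have "n * 2 ^ n \<le> 32 * queries A base"
      unfolding nm[symmetric] .
    then show "(n * 2 ^ n + 31) div 32 \<le> queries A base" by linarith
  qed
qed

lemma query_complexity_decides_le:
  assumes "n \<ge> 1" "\<And>i. i \<in> {1..n} \<Longrightarrow> 0 < w i + z"
  shows "query_complexity n (all_profiles n) (decides n w z) \<le> enat (4 * n * 2 ^ n)"
  by (rule query_complexity_le, rule solves_map[OF solves_surplus_allocation[OF assms],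
        where f = "\<lambda>out. out \<noteq> None"]) (auto simp: decides_def split: option.splits)

lemma query_complexity_computes_le:
  assumes "n \<ge> 1" "\<And>i. i \<in> {1..n} \<Longrightarrow> 0 < w i + z"
  shows "query_complexity n (all_profiles n) (computes n w z) \<le> enat (4 * n * 2 ^ n)"
  by (rule query_complexity_le, rule solves_map[OF solves_surplus_allocation[OF assms],
        where f = the]) (auto simp: computes_def split: option.splits)

text \<open>The lower bound is \<open>n * 2 ^ n / 32\<close> rounded up; the upper bound makes
  \<open>Q\<close> finite from \<open>2\<close> on.\<close>

lemma in_Theta_sandwich:
  assumes upper: "\<And>n. n \<ge> 2 \<Longrightarrow> Q n \<le> enat (4 * n * 2 ^ n)"
    and lower: "\<And>n. n \<ge> 4 \<Longrightarrow> enat ((n * 2 ^ n + 31) div 32) \<le> Q n"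
  shows "in_Theta Q (\<lambda>n. real n * 2 ^ n)"
proof -
  define q where "q n = the_enat (Q n)" for n
  have Q: "Q n = enat (q n)" if "n \<ge> 2" for n
    using upper[OF that] by (cases "Q n") (auto simp: q_def)
  have "real (q n) \<le> 4 * (real n * 2 ^ n)" if "n \<ge> 2" for n
  proof -
    have "q n \<le> 4 * n * 2 ^ n" using upper[OF that] Q[OF that] by simp
    then have "real (q n) \<le> real (4 * n * 2 ^ n)" by (simp only: of_nat_le_iff)
    then show ?thesis by simp
  qed
  then have "(\<lambda>n. real (q n)) \<in> O(\<lambda>n. real n * 2 ^ n)"
    by (intro bigoI[of _ 4] eventually_sequentiallyI[of 2]) simp
  moreover have "1 / 32 * (real n * 2 ^ n) \<le> real (q n)" if "n \<ge> 4" for n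
  proof -
    have "(n * 2 ^ n + 31) div 32 \<le> q n" using lower[OF that] Q[of n] that by simp
    then have "n * 2 ^ n \<le> 32 * q n" by linarith
    then have "real (n * 2 ^ n) \<le> real (32 * q n)" by (simp only: of_nat_le_iff)
    then show ?thesis by simp
  qed
  then have "(\<lambda>n. real (q n)) \<in> \<Omega>(\<lambda>n. real n * 2 ^ n)"
    by (intro landau_omega.bigI[of "1 / 32"] eventually_sequentiallyI[of 4]) auto
  ultimately show ?thesis
    unfolding in_Theta_def using Q by (intro exI[of _ q]) (auto simp: bigthetaI)
qed

lemma query_complexity_hungry_le:
  "query_complexity n (hungry_profiles n) R \<le> query_complexity n (all_profiles n) R"
  by (rule query_complexity_mono) (auto simp: hungry_profiles_def all_profiles_def)

theorem theorem13:
  fixes z :: "nat \<Rightarrow> real"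
  assumes "\<And>n. n \<ge> 2 \<Longrightarrow> 0 < z n \<and> z n < 1 / (real n * (real n - 1))"
  shows "in_Theta (\<lambda>n. decision_complexity n (entitlements n) (all_profiles n) (z n))
           (\<lambda>n. real n * 2 ^ n) \<and>
         in_Theta (\<lambda>n. computation_complexity n (entitlements n) (all_profiles n) (z n))
           (\<lambda>n. real n * 2 ^ n) \<and>
         in_Theta (\<lambda>n. decision_complexity n {equal_entitlements n} (hungry_profiles n) (z n))
           (\<lambda>n. real n * 2 ^ n) \<and>
         in_Theta (\<lambda>n. computation_complexity n {equal_entitlements n} (hungry_profiles n) (z n))
           (\<lambda>n. real n * 2 ^ n)"
proof (intro conjI in_Theta_sandwich)
  \<comment> \<open>Upper bounds are shown for all valuations and entitlements, lower bounds for
    hungry agents with equal ones; inclusion yields the other four.\<close>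
  have eq: "equal_entitlements n \<in> entitlements n" if "n \<ge> 2" for n
    using that by (simp add: equal_entitlements_def entitlements_def)
  have pos: "0 < w i + z n" if "n \<ge> 2" "w \<in> entitlements n" "i \<in> {1..n}" for n w i
    using that assms[of n] by (auto simp: entitlements_def intro: add_pos_pos)
  have dec: "query_complexity n (all_profiles n) (decides n w (z n)) \<le> enat (4 * n * 2 ^ n)"
    if "n \<ge> 2" "w \<in> entitlements n" for n w
    using that pos by (intro query_complexity_decides_le) auto
  have comp: "query_complexity n (all_profiles n) (computes n w (z n)) \<le> enat (4 * n * 2 ^ n)"
    if "n \<ge> 2" "w \<in> entitlements n" for n w
    using that pos by (intro query_complexity_computes_le) auto
  have dec': "enat ((n * 2 ^ n + 31) div 32)
      \<le> query_complexity n (hungry_profiles n) (decides n (equal_entitlements n) (z n))"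
    if "n \<ge> 4" for n
    using that assms[of n] by (intro query_complexity_lower_bound) (auto simp: decides_def)
  have comp': "enat ((n * 2 ^ n + 31) div 32)
      \<le> query_complexity n (hungry_profiles n) (computes n (equal_entitlements n) (z n))"
    if "n \<ge> 4" for n
    using that assms[of n] by (intro query_complexity_lower_bound) (auto simp: computes_def)
  fix n :: nat
  show "decision_complexity n (entitlements n) (all_profiles n) (z n) \<le> enat (4 * n * 2 ^ n)"
    if "n \<ge> 2"
    unfolding decision_complexity_def using dec that by (intro SUP_least)
  show "computation_complexity n (entitlements n) (all_profiles n) (z n) \<le> enat (4 * n * 2 ^ n)"
    if "n \<ge> 2"
    unfolding computation_complexity_def using comp that by (intro SUP_least)
  show "decision_complexity n {equal_entitlements n} (hungry_profiles n) (z n)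
      \<le> enat (4 * n * 2 ^ n)" if "n \<ge> 2"
    using order_trans[OF query_complexity_hungry_le dec] that eq
    by (simp add: decision_complexity_def)
  show "computation_complexity n {equal_entitlements n} (hungry_profiles n) (z n)
      \<le> enat (4 * n * 2 ^ n)" if "n \<ge> 2"
    using order_trans[OF query_complexity_hungry_le comp] that eq
    by (simp add: computation_complexity_def)
  show "enat ((n * 2 ^ n + 31) div 32)
      \<le> decision_complexity n {equal_entitlements n} (hungry_profiles n) (z n)" if "n \<ge> 4"
    using dec' that by (simp add: decision_complexity_def)
  show "enat ((n * 2 ^ n + 31) div 32)
      \<le> computation_complexity n {equal_entitlements n} (hungry_profiles n) (z n)" if "n \<ge> 4"
    using comp' that by (simp add: computation_complexity_def)
  show "enat ((n * 2 ^ n + 31) div 32)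
      \<le> decision_complexity n (entitlements n) (all_profiles n) (z n)" if "n \<ge> 4"
    unfolding decision_complexity_def
    using order_trans[OF dec' query_complexity_hungry_le] that eq[of n]
    by (intro SUP_upper2[of "equal_entitlements n"]) auto
  show "enat ((n * 2 ^ n + 31) div 32)
      \<le> computation_complexity n (entitlements n) (all_profiles n) (z n)" if "n \<ge> 4"
    unfolding computation_complexity_def
    using order_trans[OF comp' query_complexity_hungry_le] that eq[of n]
    by (intro SUP_upper2[of "equal_entitlements n"]) auto
qed

end
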